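(* Let $M$ be a complete metric space. Then $\mathcal{F}(M)$ has the Dunford–Pettis property if and only if for every compact $K\subset M$ there is a subset $B\subset M$ such that $K\subset B$ and $\mathcal{F}(B)$ has the Dunford–Pettis property.
   Context: All metric spaces come with a distinguished base point $0$. $\mathrm{Lip}_0(M)$ is the Banach space of real-valued Lipschitz functions $f$ on $M$ with $f(0)=0$, normed by the best Lipschitz constant. For $x\in M$ let $\delta(x)\in\mathrm{Lip}_0(M)^*$ be $\delta(x)(f)=f(x)$. The Lipschitz-free space is $\mathcal{F}(M)=\overline{\operatorname{span}}\{\delta(x):x\in M\}\subset\mathrm{Lip}_0(M)^*$ (norm closure). For $N\subset M$, $\mathcal{F}(N)$ is identified with the closed subspace $\overline{\operatorname{span}}\{\delta(x):x\in N\}$ of $\mathcal{F}(M)$ (canonically isometric to the free space over $N\cup\{0\}$). A Banach space $X$ has the Dunford–Pettis property if for every weakly null sequence $(x_n)_n$ in $X$ and every weakly null sequence $(x_n^* )_n$ in $X^*$ (i.e. null for $\sigma(X^*,X^{**})$), the scalars $x_n^*(x_n)$ converge to $0$. *)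

theory Defs
  imports "HOL-Analysis.Analysis"
begin

section \<open>The space of Lipschitz functions vanishing at the base point\<close>

text \<open>A pointed metric space is a type of sort \<open>{metric_space, zero}\<close>: the class \<open>zero\<close> imposes
  no axioms and only provides the constant \<open>0\<close>, which serves as the base point.\<close>

typedef (overloaded) 'a lip0 =
  "{f :: 'a::{metric_space,zero} \<Rightarrow> real. (\<exists>L. L-lipschitz_on UNIV f) \<and> f 0 = 0}"
  morphisms lip0_apply Lip0
proof -
  have "0-lipschitz_on UNIV (\<lambda>_::'a. 0 :: real)"
    by (rule lipschitz_onI) auto
  then show ?thesis by blast
qed

setup_lifting type_definition_lip0

lemma lip0_eqI: "(\<And>x. lip0_apply f x = lip0_apply g x) \<Longrightarrow> f = g"
  by (metis ext lip0_apply_inject)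

lemma lip0_apply_zero_point [simp]: "lip0_apply f 0 = 0"
  using lip0_apply[of f] by simp

instantiation lip0 :: ("{metric_space,zero}") real_vector
begin

lift_definition zero_lip0 :: "'a lip0" is "\<lambda>_. 0"
  by (auto intro!: exI[of _ 0] lipschitz_onI)

lift_definition plus_lip0 :: "'a lip0 \<Rightarrow> 'a lip0 \<Rightarrow> 'a lip0" is "\<lambda>f g x. f x + g x"
  by (auto intro: lipschitz_on_add)

lift_definition scaleR_lip0 :: "real \<Rightarrow> 'a lip0 \<Rightarrow> 'a lip0" is "\<lambda>c f x. c * f x"
  using lipschitz_on_cmult_real by fastforce

lift_definition uminus_lip0 :: "'a lip0 \<Rightarrow> 'a lip0" is "\<lambda>f x. - f x"
  by (auto simp: lipschitz_on_minus_iff)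

lift_definition minus_lip0 :: "'a lip0 \<Rightarrow> 'a lip0 \<Rightarrow> 'a lip0" is "\<lambda>f g x. f x - g x"
  by (auto intro: lipschitz_on_diff)

instance
  by standard (transfer; auto simp: algebra_simps)+

end

instantiation lip0 :: ("{metric_space,zero}") real_normed_vector
begin

definition norm_lip0 :: "'a lip0 \<Rightarrow> real" where
  "norm_lip0 f = Inf {L. L-lipschitz_on UNIV (lip0_apply f)}"

definition dist_lip0 :: "'a lip0 \<Rightarrow> 'a lip0 \<Rightarrow> real" where
  "dist_lip0 f g = norm (f - g)"

definition sgn_lip0 :: "'a lip0 \<Rightarrow> 'a lip0" where
  "sgn_lip0 f = inverse (norm f) *\<^sub>R f"

definition uniformity_lip0 :: "('a lip0 \<times> 'a lip0) filter" where
  "uniformity_lip0 = (INF e\<in>{0<..}. principal {(f, g). dist f g < e})"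

definition open_lip0 :: "'a lip0 set \<Rightarrow> bool" where
  "open_lip0 U \<longleftrightarrow> (\<forall>f\<in>U. eventually (\<lambda>(f', g). f' = f \<longrightarrow> g \<in> U) uniformity)"

lemma lipschitz_on_norm_lip0: "(norm f)-lipschitz_on UNIV (lip0_apply f)"
  for f :: "'a lip0"
proof -
  let ?S = "{L. L-lipschitz_on UNIV (lip0_apply f)}"
  have ne: "?S \<noteq> {}"
    using lip0_apply[of f] by auto
  show ?thesis
  proof (rule lipschitz_onI)
    fix x y :: 'a
    show "dist (lip0_apply f x) (lip0_apply f y) \<le> norm f * dist x y"
    proof (cases "x = y")
      case False
      have "dist (lip0_apply f x) (lip0_apply f y) / dist x y \<le> Inf ?S"
      proof (rule cInf_greatest[OF ne])
        fix L assume "L \<in> ?S"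
        then show "dist (lip0_apply f x) (lip0_apply f y) / dist x y \<le> L"
          using False by (auto simp: divide_simps dest: lipschitz_onD)
      qed
      with False show ?thesis by (simp add: norm_lip0_def divide_simps)
    qed simp
  next
    show "0 \<le> norm f"
      unfolding norm_lip0_def
      by (rule cInf_greatest[OF ne]) (auto dest: lipschitz_on_nonneg)
  qed
qed

lemma norm_lip0_le: "L-lipschitz_on UNIV (lip0_apply f) \<Longrightarrow> norm f \<le> L"
  for f :: "'a lip0"
  unfolding norm_lip0_def
  by (rule cInf_lower) (auto intro!: bdd_belowI[of _ 0] dest: lipschitz_on_nonneg)

instance
proof
  fix f g :: "'a lip0" and c :: real
  show "(norm f = 0) = (f = 0)"
  proof
    assume "norm f = 0"
    then have "lip0_apply f x = 0" for x
      using lipschitz_onD[OF lipschitz_on_norm_lip0[of f], of x 0] by simp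
    then show "f = 0" by (intro lip0_eqI) (simp add: zero_lip0.rep_eq)
  next
    assume "f = 0"
    then have "0-lipschitz_on UNIV (lip0_apply f)"
      by (auto simp: zero_lip0.rep_eq intro: lipschitz_onI)
    then show "norm f = 0"
      using norm_lip0_le[of 0 f] lipschitz_on_nonneg[OF lipschitz_on_norm_lip0[of f]] by simp
  qed
  show "norm (f + g) \<le> norm f + norm g"
    by (rule norm_lip0_le)
      (auto simp: plus_lip0.rep_eq intro!: lipschitz_on_add lipschitz_on_norm_lip0)
  have le: "norm (c *\<^sub>R f) \<le> \<bar>c\<bar> * norm f" for c and f :: "'a lip0"
    by (rule norm_lip0_le)
      (auto simp: scaleR_lip0.rep_eq intro!: lipschitz_on_cmult_real lipschitz_on_norm_lip0)
  show "norm (c *\<^sub>R f) = \<bar>c\<bar> * norm f"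
  proof (cases "c = 0")
    case True
    then show ?thesis
      using le[of c f] lipschitz_on_nonneg[OF lipschitz_on_norm_lip0[of "c *\<^sub>R f"]] by simp
  next
    case False
    then have "norm f \<le> \<bar>inverse c\<bar> * norm (c *\<^sub>R f)"
      using le[of "inverse c" "c *\<^sub>R f"] by simp
    with False have "\<bar>c\<bar> * norm f \<le> norm (c *\<^sub>R f)"
      by (simp add: field_simps)
    with le[of c f] show ?thesis by simp
  qed
qed (simp_all add: dist_lip0_def sgn_lip0_def uniformity_lip0_def open_lip0_def)

end

section \<open>Lipschitz-free spaces\<close>

lift_definition lip0_eval :: "'a::{metric_space,zero} \<Rightarrow> 'a lip0 \<Rightarrow>\<^sub>L real"
  is "\<lambda>x f. lip0_apply f x"
proof (rule bounded_linear_intro)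
  fix x :: 'a and f :: "'a lip0"
  show "norm (lip0_apply f x) \<le> norm f * dist x 0"
    using lipschitz_onD[OF lipschitz_on_norm_lip0[of f], of x 0] by simp
qed (simp_all add: plus_lip0.rep_eq scaleR_lip0.rep_eq)

text \<open>The free space over a subset \<open>N\<close>, as a closed subspace of the free space over the whole
  metric space; the latter is \<open>lip_free UNIV\<close>.\<close>

definition lip_free :: "'a::{metric_space,zero} set \<Rightarrow> ('a lip0 \<Rightarrow>\<^sub>L real) set" where
  "lip_free N = closure (span (lip0_eval ` N))"

section \<open>The Dunford--Pettis property of a linear subspace\<close>

text \<open>Since a subspace \<open>X\<close> is not a type, its dual is a set of functions on the ambient type.
  Functionals are required to vanish off \<open>X\<close>, so that two functionals on \<open>X\<close> are
  equal if and only if they are equal as functions, and the vector space operations of the dual are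
  pointwise.\<close>

definition dual_on :: "'b::real_normed_vector set \<Rightarrow> ('b \<Rightarrow> real) set" where
  "dual_on X = {f.
     (\<forall>x\<in>X. \<forall>y\<in>X. f (x + y) = f x + f y) \<and>
     (\<forall>c. \<forall>x\<in>X. f (c *\<^sub>R x) = c * f x) \<and>
     (\<exists>C. \<forall>x\<in>X. \<bar>f x\<bar> \<le> C * norm x) \<and>
     (\<forall>x. x \<notin> X \<longrightarrow> f x = 0)}"

definition dual_norm_on :: "'b::real_normed_vector set \<Rightarrow> ('b \<Rightarrow> real) \<Rightarrow> real" where
  "dual_norm_on X f = (SUP x\<in>{x\<in>X. norm x \<le> 1}. \<bar>f x\<bar>)"

definition bidual_on :: "'b::real_normed_vector set \<Rightarrow> (('b \<Rightarrow> real) \<Rightarrow> real) set" where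
  "bidual_on X = {\<phi>.
     (\<forall>f\<in>dual_on X. \<forall>g\<in>dual_on X. \<phi> (\<lambda>x. f x + g x) = \<phi> f + \<phi> g) \<and>
     (\<forall>c. \<forall>f\<in>dual_on X. \<phi> (\<lambda>x. c * f x) = c * \<phi> f) \<and>
     (\<exists>C. \<forall>f\<in>dual_on X. \<bar>\<phi> f\<bar> \<le> C * dual_norm_on X f) \<and>
     (\<forall>f. f \<notin> dual_on X \<longrightarrow> \<phi> f = 0)}"

definition weakly_null_on :: "'b::real_normed_vector set \<Rightarrow> (nat \<Rightarrow> 'b) \<Rightarrow> bool" where
  "weakly_null_on X x \<longleftrightarrow> (\<forall>n. x n \<in> X) \<and> (\<forall>f\<in>dual_on X. (\<lambda>n. f (x n)) \<longlonglongrightarrow> 0)"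

definition dual_weakly_null_on ::
  "'b::real_normed_vector set \<Rightarrow> (nat \<Rightarrow> 'b \<Rightarrow> real) \<Rightarrow> bool" where
  "dual_weakly_null_on X f \<longleftrightarrow>
     (\<forall>n. f n \<in> dual_on X) \<and> (\<forall>\<phi>\<in>bidual_on X. (\<lambda>n. \<phi> (f n)) \<longlonglongrightarrow> 0)"

definition dunford_pettis_on :: "'b::real_normed_vector set \<Rightarrow> bool" where
  "dunford_pettis_on X \<longleftrightarrow>
     (\<forall>x f. weakly_null_on X x \<and> dual_weakly_null_on X f \<longrightarrow> (\<lambda>n. f n (x n)) \<longlonglongrightarrow> 0)"

end

theory Submission
  imports Defs
begin

text \<open>A weakly null sequence \<open>x\<^sub>n\<close> in the free space is, up to a null sequence, a weakly null sequence
  \<open>\<mu>\<^sub>n\<close> of finitely supported elements. A gliding hump argument shows that such a sequence is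
  tight: for all \<open>\<epsilon>, \<delta>\<close> there is a finite \<open>E\<close> such that multiplication by a cutoff function
  around \<open>E\<close> changes every \<open>\<mu>\<^sub>n\<close> by at most \<open>\<epsilon>\<close>. Otherwise one finds Lipschitz functions with
  separated supports on which a subsequence stays large, and their sum contradicts weak nullness.
  Multiplying by cutoffs for a sequence \<open>\<delta>\<^sub>k \<rightarrow> 0\<close> gives, in the limit, a weakly null sequence
  \<open>y\<^sub>n\<close> with \<open>\<parallel>\<mu>\<^sub>n - y\<^sub>n\<parallel> \<le> \<epsilon>\<close>. Since the \<open>\<mu>\<^sub>n\<close> have finite support, the limit simply erases the
  points at which the infinite product of cutoffs vanishes, so all \<open>y\<^sub>n\<close> live on one compact set
  \<open>K\<close>. The Dunford--Pettis property of the free space over some \<open>B \<supseteq> K\<close> applies to \<open>y\<^sub>n\<close>, and the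
  functionals are uniformly bounded, so replacing \<open>x\<^sub>n\<close> by \<open>y\<^sub>n\<close> costs little.\<close>

section \<open>Weighting operators\<close>

lemma lip0_apply_add [simp]: "lip0_apply (f + g) x = lip0_apply f x + lip0_apply g x"
  by (simp add: plus_lip0.rep_eq)

lemma lip0_apply_scaleR [simp]: "lip0_apply (c *\<^sub>R f) x = c * lip0_apply f x"
  by (simp add: scaleR_lip0.rep_eq)

lemma lip0_apply_diff [simp]: "lip0_apply (f - g) x = lip0_apply f x - lip0_apply g x"
  by (simp add: minus_lip0.rep_eq)

lemma lip0_apply_0 [simp]: "lip0_apply 0 x = 0"
  by (simp add: zero_lip0.rep_eq)

lemma lip0_eval_apply [simp]: "blinfun_apply (lip0_eval x) f = lip0_apply f x"
  by (simp add: lip0_eval.rep_eq)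

lemma lip0_dist_le: "\<bar>lip0_apply f x - lip0_apply f y\<bar> \<le> norm f * dist x y"
  using lipschitz_onD[OF lipschitz_on_norm_lip0[of f], of x y] by (simp add: dist_real_def)

lemma lip0_abs_le: "\<bar>lip0_apply f x\<bar> \<le> norm f * dist x 0"
  using lip0_dist_le[of f x 0] by simp

lemma Lip0_works:
  assumes "0 \<le> L" and "\<And>x y. \<bar>F x - F y\<bar> \<le> L * dist x y" and "F 0 = 0"
  shows lip0_apply_Lip0: "lip0_apply (Lip0 F) = F" and norm_Lip0_le: "norm (Lip0 F) \<le> L"
proof -
  have lip: "L-lipschitz_on UNIV F"
    by (rule lipschitz_onI) (use assms in \<open>auto simp: dist_real_def\<close>)
  show "lip0_apply (Lip0 F) = F"
    by (rule Lip0_inverse) (use lip assms(3) in auto)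
  then show "norm (Lip0 F) \<le> L"
    using lip by (intro norm_lip0_le) simp
qed

lemma norm_lip0_eval_diff_le: "norm (lip0_eval x - lip0_eval y) \<le> dist x y"
  by (rule norm_blinfun_bound)
    (simp_all add: blinfun.diff_left mult.commute[of "dist x y"] lip0_dist_le)

text \<open>An element of the span only sees values on \<open>S\<close>, so a test function may be
  altered freely elsewhere.\<close>

lemma span_lip0_eval_cong:
  assumes "\<gamma> \<in> span (lip0_eval ` S)" and "\<And>x. x \<in> S \<Longrightarrow> lip0_apply f x = lip0_apply g x"
  shows "blinfun_apply \<gamma> f = blinfun_apply \<gamma> g"
  using assms(1)
  by (induction rule: span_induct_alt)
    (auto simp: blinfun.add_left blinfun.scaleR_left assms(2))

lemma span_lip0_eval_finite:
  assumes "\<gamma> \<in> span (lip0_eval ` N)"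
  obtains S where "finite S" "S \<subseteq> N" "\<gamma> \<in> span (lip0_eval ` S)"
proof -
  from assms obtain t r where t: "finite t" "t \<subseteq> lip0_eval ` N" and \<gamma>: "\<gamma> = (\<Sum>a\<in>t. r a *\<^sub>R a)"
    unfolding span_explicit by blast
  obtain S where S: "S \<subseteq> N" "finite S" "t = lip0_eval ` S"
    using finite_subset_image[OF t] by blast
  have "\<gamma> \<in> span t"
    unfolding \<gamma> by (intro span_sum span_scale span_base)
  with S show thesis by (intro that) auto
qed

text \<open>The last condition is the one under which \<open>f \<mapsto> h f\<close> is bounded on Lipschitz functions
  vanishing at \<open>0\<close>, also over an unbounded space, since \<open>\<bar>f x\<bar>\<close> is only controlled by
  \<open>dist x 0\<close>.\<close>

definition weight :: "real \<Rightarrow> ('a::{metric_space,zero} \<Rightarrow> real) \<Rightarrow> bool" where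
  "weight C h \<longleftrightarrow> 0 \<le> C \<and> (\<forall>x. 0 \<le> h x \<and> h x \<le> 1) \<and>
     (\<forall>x y. \<bar>h x - h y\<bar> * dist x 0 \<le> C * dist x y)"

lemma weight_nonneg: "weight C h \<Longrightarrow> 0 \<le> C"
  and weight_ge_0: "weight C h \<Longrightarrow> 0 \<le> h x"
  and weight_le_1: "weight C h \<Longrightarrow> h x \<le> 1"
  and weight_diff: "weight C h \<Longrightarrow> \<bar>h x - h y\<bar> * dist x 0 \<le> C * dist x y"
  by (auto simp: weight_def)

lemma weight_1: "weight 0 (\<lambda>_. 1)"
  by (simp add: weight_def)

lemma weight_compl: "weight C h \<Longrightarrow> weight C (\<lambda>x. 1 - h x)"
  by (auto simp: weight_def abs_minus_commute)

lemma weight_mult: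
  assumes "weight C h" and "weight D k"
  shows "weight (C + D) (\<lambda>x. h x * k x)"
  unfolding weight_def
proof (intro conjI allI)
  fix x y
  have "\<bar>h x * k x - h y * k y\<bar> = \<bar>(h x - h y) * k x + h y * (k x - k y)\<bar>"
    by (simp add: algebra_simps)
  also have "\<dots> \<le> \<bar>h x - h y\<bar> * k x + h y * \<bar>k x - k y\<bar>"
    using weight_ge_0[OF assms(2), of x] weight_ge_0[OF assms(1), of y]
    by (intro order_trans[OF abs_triangle_ineq]) (simp add: abs_mult)
  also have "\<dots> \<le> \<bar>h x - h y\<bar> * 1 + 1 * \<bar>k x - k y\<bar>"
    using weight_le_1[OF assms(2), of x] weight_le_1[OF assms(1), of y]
    by (intro add_mono mult_left_mono mult_right_mono) auto
  finally have "\<bar>h x * k x - h y * k y\<bar> * dist x 0 \<le> (\<bar>h x - h y\<bar> + \<bar>k x - k y\<bar>) * dist x 0"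
    by (intro mult_right_mono) auto
  then show "\<bar>h x * k x - h y * k y\<bar> * dist x 0 \<le> (C + D) * dist x y"
    using weight_diff[OF assms(1), of x y] weight_diff[OF assms(2), of x y]
    by (simp add: algebra_simps)
qed (use assms in \<open>auto simp: weight_def mult_le_one\<close>)

section \<open>Multiplication by a weight and its adjoint\<close>

definition lip0_mult :: "('a::{metric_space,zero} \<Rightarrow> real) \<Rightarrow> 'a lip0 \<Rightarrow> 'a lip0" where
  "lip0_mult h f = Lip0 (\<lambda>x. h x * lip0_apply f x)"

text \<open>In the product-rule splitting the increment of \<open>h\<close> is multiplied by
  \<open>lip0_apply f x\<close>, which is at most \<open>norm f * dist x 0\<close> in absolute
  value; the weight condition absorbs exactly this growth.\<close>

lemma
  assumes "weight C h"
  shows lip0_apply_mult: "lip0_apply (lip0_mult h f) x = h x * lip0_apply f x"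
    and norm_lip0_mult_le: "norm (lip0_mult h f) \<le> (1 + C) * norm f"
proof -
  have bd: "\<bar>h x * lip0_apply f x - h y * lip0_apply f y\<bar> \<le> (1 + C) * norm f * dist x y" for x y
  proof -
    have "\<bar>h x * lip0_apply f x - h y * lip0_apply f y\<bar>
        = \<bar>(h x - h y) * lip0_apply f x + h y * (lip0_apply f x - lip0_apply f y)\<bar>"
      by (simp add: algebra_simps)
    also have "\<dots> \<le> \<bar>h x - h y\<bar> * \<bar>lip0_apply f x\<bar> + h y * \<bar>lip0_apply f x - lip0_apply f y\<bar>"
      using weight_ge_0[OF assms, of y]
      by (intro order_trans[OF abs_triangle_ineq]) (simp add: abs_mult)
    also have "\<dots> \<le> \<bar>h x - h y\<bar> * (norm f * dist x 0) + 1 * (norm f * dist x y)"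
      by (intro add_mono mult_mono lip0_abs_le lip0_dist_le weight_le_1[OF assms]) auto
    also have "\<dots> \<le> norm f * (C * dist x y) + norm f * dist x y"
      using mult_left_mono[OF weight_diff[OF assms, of x y] norm_ge_zero[of f]]
      by (simp add: algebra_simps)
    finally show ?thesis by (simp add: algebra_simps)
  qed
  have "0 \<le> (1 + C) * norm f"
    using weight_nonneg[OF assms] by simp
  from Lip0_works[OF this bd] show "lip0_apply (lip0_mult h f) x = h x * lip0_apply f x"
    and "norm (lip0_mult h f) \<le> (1 + C) * norm f"
    by (simp_all add: lip0_mult_def)
qed

lemma bounded_linear_lip0_mult:
  assumes "weight C h"
  shows "bounded_linear (lip0_mult h)"
proof (rule bounded_linear_intro[where K = "1 + C"])
  fix f show "norm (lip0_mult h f) \<le> norm f * (1 + C)"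
    using norm_lip0_mult_le[OF assms, of f] by (simp add: mult.commute)
qed (auto intro!: lip0_eqI simp: lip0_apply_mult[OF assms] algebra_simps)

text \<open>The adjoint of \<open>lip0_mult h\<close>: a point mass at \<open>x\<close> is scaled by
  \<open>h x\<close>. \<open>Blinfun\<close> is meaningful only for bounded linear maps, so
  evaluating the definition takes a \<open>weight\<close> hypothesis.\<close>

definition weigh ::
  "('a::{metric_space,zero} \<Rightarrow> real) \<Rightarrow> ('a lip0 \<Rightarrow>\<^sub>L real) \<Rightarrow> ('a lip0 \<Rightarrow>\<^sub>L real)" where
  "weigh h \<gamma> = \<gamma> o\<^sub>L Blinfun (lip0_mult h)"

lemma weigh_apply:
  assumes "weight C h"
  shows "blinfun_apply (weigh h \<gamma>) f = blinfun_apply \<gamma> (lip0_mult h f)"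
  by (simp add: weigh_def bounded_linear_Blinfun_apply[OF bounded_linear_lip0_mult[OF assms]])

lemma weigh_add: "weigh h (\<gamma> + \<gamma>') = weigh h \<gamma> + weigh h \<gamma>'"
  and weigh_diff: "weigh h (\<gamma> - \<gamma>') = weigh h \<gamma> - weigh h \<gamma>'"
  and weigh_scaleR: "weigh h (c *\<^sub>R \<gamma>) = c *\<^sub>R weigh h \<gamma>"
  and weigh_zero: "weigh h 0 = 0"
  by (auto intro!: blinfun_eqI
      simp: weigh_def blinfun.add_left blinfun.diff_left blinfun.scaleR_left)

lemma weigh_1: "weigh (\<lambda>_. 1) \<gamma> = \<gamma>"
  by (intro blinfun_eqI) (simp add: weigh_apply[OF weight_1] lip0_mult_def lip0_apply_inverse)

lemma weigh_compl: "weight C h \<Longrightarrow> weigh (\<lambda>x. 1 - h x) \<gamma> = \<gamma> - weigh h \<gamma>"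
proof (rule blinfun_eqI)
  fix f
  assume h: "weight C h"
  have "lip0_mult (\<lambda>x. 1 - h x) f = f - lip0_mult h f"
    by (rule lip0_eqI)
      (simp add: lip0_apply_mult[OF h] lip0_apply_mult[OF weight_compl[OF h]] algebra_simps)
  then show "blinfun_apply (weigh (\<lambda>x. 1 - h x) \<gamma>) f = blinfun_apply (\<gamma> - weigh h \<gamma>) f"
    by (simp add: weigh_apply[OF h] weigh_apply[OF weight_compl[OF h]] blinfun.diff_left
        blinfun.diff_right)
qed

lemma weigh_weigh:
  assumes "weight C h" and "weight D k"
  shows "weigh h (weigh k \<gamma>) = weigh (\<lambda>x. h x * k x) \<gamma>"
proof (rule blinfun_eqI)
  fix f
  have "lip0_mult k (lip0_mult h f) = lip0_mult (\<lambda>x. h x * k x) f"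
    by (rule lip0_eqI)
      (simp add: lip0_apply_mult[OF assms(1)] lip0_apply_mult[OF assms(2)]
        lip0_apply_mult[OF weight_mult[OF assms]])
  then show "blinfun_apply (weigh h (weigh k \<gamma>)) f = blinfun_apply (weigh (\<lambda>x. h x * k x) \<gamma>) f"
    by (simp add: weigh_apply[OF assms(1)] weigh_apply[OF assms(2)]
        weigh_apply[OF weight_mult[OF assms]])
qed

lemma norm_weigh_le:
  assumes "weight C h"
  shows "norm (weigh h \<gamma>) \<le> (1 + C) * norm \<gamma>"
proof (rule norm_blinfun_bound)
  show "0 \<le> (1 + C) * norm \<gamma>"
    using weight_nonneg[OF assms] by simp
  fix f
  have "norm (blinfun_apply (weigh h \<gamma>) f) \<le> norm \<gamma> * norm (lip0_mult h f)"
    using norm_blinfun[of \<gamma> "lip0_mult h f"] by (simp add: weigh_apply[OF assms])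
  also have "\<dots> \<le> norm \<gamma> * ((1 + C) * norm f)"
    by (intro mult_left_mono norm_lip0_mult_le[OF assms]) simp
  finally show "norm (blinfun_apply (weigh h \<gamma>) f) \<le> (1 + C) * norm \<gamma> * norm f"
    by (simp add: algebra_simps)
qed

lemma weigh_lip0_eval: "weight C h \<Longrightarrow> weigh h (lip0_eval x) = h x *\<^sub>R lip0_eval x"
  by (rule blinfun_eqI) (simp add: weigh_apply lip0_apply_mult blinfun.scaleR_left)

text \<open>The neighbourhoods of \<open>E\<close> have width proportional to \<open>dist x 0\<close>, which makes the constant of
  the weight independent of \<open>E\<close>. At the base point \<open>0 / 0 = 0\<close> gives the value 1.\<close>

definition cutoff :: "real \<Rightarrow> 'a::{metric_space,zero} set \<Rightarrow> 'a \<Rightarrow> real" where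
  "cutoff \<delta> E x = max 0 (min 1 (2 - infdist x E / (\<delta> * dist x 0)))"

lemma cutoff_eq_1:
  assumes "0 < \<delta>" and "infdist x E \<le> \<delta> * dist x 0"
  shows "cutoff \<delta> E x = 1"
proof -
  have "infdist x E / (\<delta> * dist x 0) \<le> 1"
    using assms by (cases "x = 0") (auto simp: divide_simps)
  then show ?thesis by (simp add: cutoff_def)
qed

text \<open>The support is at most twice as wide as the region of \<open>cutoff_eq_1\<close>. At the
  base point the right side is 0, and \<open>0 \<in> E\<close> makes the left side 0 as
  well.\<close>

lemma infdist_le_of_cutoff:
  assumes "0 < \<delta>" and "0 \<in> E" and "cutoff \<delta> E x \<noteq> 0"
  shows "infdist x E \<le> 2 * \<delta> * dist x 0"
proof (cases "x = 0")
  case False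
  then have "infdist x E / (\<delta> * dist x 0) < 2"
    using assms(3) by (auto simp: cutoff_def max_def split: if_splits)
  with False assms(1) show ?thesis by (simp add: divide_simps)
qed (use assms in simp)

text \<open>Clamping does not increase differences, so only the quotient counts.
  \<open>infdist\<close> and the distance to the base point are both 1-Lipschitz, and
  \<open>0 \<in> E\<close> bounds their quotient by 1; each contributes
  \<open>1 / \<delta>\<close>.\<close>

lemma weight_cutoff:
  fixes E :: "'a::{metric_space,zero} set"
  assumes \<delta>: "0 < \<delta>" "\<delta> \<le> 1" and E: "0 \<in> E"
  shows "weight (2 / \<delta>) (cutoff \<delta> E)"
  unfolding weight_def
proof (intro conjI allI)
  fix x y :: 'a
  show "\<bar>cutoff \<delta> E x - cutoff \<delta> E y\<bar> * dist x 0 \<le> 2 / \<delta> * dist x y"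
  proof (cases "x = 0 \<or> y = 0")
    case True
    have "\<bar>cutoff \<delta> E x - cutoff \<delta> E y\<bar> \<le> 1"
      by (auto simp: cutoff_def)
    moreover have "1 \<le> 2 / \<delta>"
      using \<delta> by (simp add: divide_simps)
    ultimately have "\<bar>cutoff \<delta> E x - cutoff \<delta> E y\<bar> \<le> 2 / \<delta>"
      by linarith
    then have "\<bar>cutoff \<delta> E x - cutoff \<delta> E y\<bar> * dist x 0 \<le> 2 / \<delta> * dist x 0"
      by (intro mult_right_mono) auto
    with True show ?thesis
      using \<delta> by auto
  next
    case False
    define p q a b where "p = dist x 0" and "q = dist y 0" and "a = infdist x E" and "b = infdist y E"
    have pos: "0 < p" "0 < q"
      using False by (auto simp: p_def q_def)
    have b: "0 \<le> b" "b \<le> q"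
      using infdist_le[OF E, of y] by (auto simp: b_def q_def infdist_nonneg)
    have ab: "\<bar>a - b\<bar> \<le> dist x y"
      unfolding a_def b_def by (rule infdist_triangle_abs)
    have pq: "\<bar>q - p\<bar> \<le> dist x y"
      unfolding p_def q_def using abs_dist_diff_le[of x 0 y]
      by (smt (verit) dist_commute dist_triangle)
    have "\<bar>cutoff \<delta> E x - cutoff \<delta> E y\<bar> \<le> \<bar>a / (\<delta> * p) - b / (\<delta> * q)\<bar>"
      unfolding cutoff_def p_def q_def a_def b_def by linarith
    then have "\<bar>cutoff \<delta> E x - cutoff \<delta> E y\<bar> * p \<le> \<bar>a / (\<delta> * p) - b / (\<delta> * q)\<bar> * p"
      using pos by (intro mult_right_mono) auto
    also have "\<dots> = \<bar>(a / (\<delta> * p) - b / (\<delta> * q)) * p\<bar>"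
      using pos by (simp add: abs_mult)
    \<comment> \<open>Multiplication by \<open>p\<close> clears the denominator that may be small.
      The remaining coefficient \<open>b / q\<close> is at most 1.\<close>
    also have "(a / (\<delta> * p) - b / (\<delta> * q)) * p = ((a - b) + b / q * (q - p)) / \<delta>"
      using pos \<delta> by (simp add: field_simps)
    also have "\<bar>\<dots>\<bar> = \<bar>(a - b) + b / q * (q - p)\<bar> / \<delta>"
      using \<delta> by simp
    also have "\<dots> \<le> (dist x y + 1 * dist x y) / \<delta>"
    proof (intro divide_right_mono order_trans[OF abs_triangle_ineq] add_mono ab)
      have "\<bar>b / q * (q - p)\<bar> = b / q * \<bar>q - p\<bar>"
        using b pos by (simp add: abs_mult)
      also have "\<dots> \<le> 1 * dist x y"
        using b pos pq by (intro mult_mono) (auto simp: divide_simps)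
      finally show "\<bar>b / q * (q - p)\<bar> \<le> 1 * dist x y" .
    qed (use \<delta> in simp)
    finally show ?thesis
      by (simp add: p_def)
  qed
qed (use \<delta> in \<open>auto simp: cutoff_def\<close>)

section \<open>Tightness of weakly null sequences\<close>

lemma blinfun_norming:
  fixes \<gamma> :: "'b::real_normed_vector \<Rightarrow>\<^sub>L real"
  assumes "\<epsilon> < norm \<gamma>" and "0 \<le> \<epsilon>"
  obtains f where "norm f \<le> 1" and "\<epsilon> < blinfun_apply \<gamma> f"
proof -
  have False if *: "\<And>f. norm f \<le> 1 \<Longrightarrow> blinfun_apply \<gamma> f \<le> \<epsilon>"
  proof -
    have "norm (blinfun_apply \<gamma> f) \<le> \<epsilon> * norm f" for f
    proof (cases "f = 0")
      case False
      \<comment> \<open>The assumption is one-sided; testing both signs of the normalised vector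
        bounds the absolute value.\<close>
      have "blinfun_apply \<gamma> ((1 / norm f) *\<^sub>R f) \<le> \<epsilon>" "blinfun_apply \<gamma> ((- 1 / norm f) *\<^sub>R f) \<le> \<epsilon>"
        by (rule *; simp)+
      with False show ?thesis
        by (simp add: blinfun.scaleR_right blinfun.minus_right field_simps)
    qed (simp add: blinfun.zero_right)
    with assms show False
      using norm_blinfun_bound[of \<epsilon> \<gamma>] by fastforce
  qed
  then show thesis
    using that by force
qed

text \<open>One stage of the gliding hump. \<open>P\<close> is the sum of the earlier humps and
  \<open>E\<close> collects the supports already used. The new hump vanishes on the relative
  \<open>\<delta>\<close>-neighbourhood of \<open>E\<close> but lives in the relative
  \<open>\<delta> / 4\<close>-neighbourhood of \<open>E'\<close>; the gap between the two widths
  separates it from later humps.\<close>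

lemma separated_hump:
  fixes \<mu> :: "nat \<Rightarrow> 'a::{metric_space,zero} lip0 \<Rightarrow>\<^sub>L real"
  assumes span: "\<And>n. \<mu> n \<in> span (range lip0_eval)"
    and null: "\<And>f. (\<lambda>n. blinfun_apply (\<mu> n) f) \<longlonglongrightarrow> 0"
    and \<epsilon>: "0 < \<epsilon>" and \<delta>: "0 < \<delta>" "\<delta> \<le> 1"
    and not_tight: "\<forall>E. finite E \<and> 0 \<in> E \<longrightarrow> (\<exists>n. \<epsilon> < norm (weigh (\<lambda>x. 1 - cutoff \<delta> E x) (\<mu> n)))"
    and E: "finite E" "0 \<in> E"
  obtains n E' g where "N \<le> n" "finite E'" "E \<subseteq> E'" "\<mu> n \<in> span (lip0_eval ` E')"
    "\<bar>blinfun_apply (\<mu> n) P\<bar> \<le> \<epsilon> / 2" "\<epsilon> < blinfun_apply (\<mu> n) g"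
    "norm g \<le> (1 + 16 / \<delta>) * (1 + 2 / \<delta>)"
    "\<forall>x. infdist x E \<le> \<delta> * dist x 0 \<longrightarrow> lip0_apply g x = 0"
    "\<forall>x. lip0_apply g x \<noteq> 0 \<longrightarrow> infdist x E' \<le> \<delta> / 4 * dist x 0"
proof -
  have "\<exists>S. finite S \<and> \<mu> n \<in> span (lip0_eval ` S)" for n
    by (rule span_lip0_eval_finite[OF span[of n]]) blast
  then obtain S where S: "\<And>n. finite (S n)" "\<And>n. \<mu> n \<in> span (lip0_eval ` S n)"
    by metis
  obtain N' where N': "\<And>n. N' \<le> n \<Longrightarrow> \<bar>blinfun_apply (\<mu> n) P\<bar> < \<epsilon> / 2"
    using LIMSEQ_D[OF null[of P], of "\<epsilon> / 2"] \<epsilon> by auto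
  \<comment> \<open>\<open>A\<close> also absorbs the supports of the first \<open>max N N'\<close>
    elements. The function \<open>k\<close> below vanishes on these supports, so failure of
    tightness at \<open>A\<close> must produce a later index.\<close>
  define A where "A = E \<union> (\<Union>n<max N N'. S n)"
  have A: "finite A" "0 \<in> A" "E \<subseteq> A"
    using E S by (auto simp: A_def)
  note wA = weight_compl[OF weight_cutoff[OF \<delta> A(2)]]
  obtain n where "\<epsilon> < norm (weigh (\<lambda>x. 1 - cutoff \<delta> A x) (\<mu> n))"
    using not_tight A(1,2) by blast
  then obtain f where f: "norm f \<le> 1" "\<epsilon> < blinfun_apply (weigh (\<lambda>x. 1 - cutoff \<delta> A x) (\<mu> n)) f"
    using \<epsilon> by (meson blinfun_norming less_imp_le)
  define k where "k = lip0_mult (\<lambda>x. 1 - cutoff \<delta> A x) f"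
  have k: "\<epsilon> < blinfun_apply (\<mu> n) k" "norm k \<le> 1 + 2 / \<delta>"
  proof -
    show "\<epsilon> < blinfun_apply (\<mu> n) k"
      using f(2) by (simp add: k_def weigh_apply[OF wA])
    have "norm k \<le> (1 + 2 / \<delta>) * norm f"
      unfolding k_def by (rule norm_lip0_mult_le[OF wA])
    also have "\<dots> \<le> (1 + 2 / \<delta>) * 1"
      using \<delta> f by (intro mult_left_mono) auto
    finally show "norm k \<le> 1 + 2 / \<delta>" by simp
  qed
  have k0: "lip0_apply k x = 0" if "infdist x A \<le> \<delta> * dist x 0" for x
    using cutoff_eq_1[OF \<delta>(1) that] by (simp add: k_def lip0_apply_mult[OF wA])
  have n: "max N N' \<le> n"
  proof (rule ccontr)
    assume "\<not> ?thesis"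
    then have "S n \<subseteq> A"
      by (auto simp: A_def)
    have "lip0_apply k x = lip0_apply 0 x" if "x \<in> S n" for x
    proof -
      have "infdist x A = 0"
        using that \<open>S n \<subseteq> A\<close> by auto
      then show ?thesis
        using k0[of x] \<delta> by simp
    qed
    then have "blinfun_apply (\<mu> n) k = blinfun_apply (\<mu> n) 0"
      by (rule span_lip0_eval_cong[OF S(2)])
    with k(1) \<epsilon> show False
      by (simp add: blinfun.zero_right)
  qed
  \<comment> \<open>Only \<open>S n\<close> is added to \<open>E\<close>: the rest of
    \<open>A\<close> served to force \<open>n\<close> to be late.\<close>
  define E' where "E' = E \<union> S n"
  have E': "finite E'" "0 \<in> E'" "E \<subseteq> E'" "S n \<subseteq> E'"
    using E S by (auto simp: E'_def)
  \<comment> \<open>The support of a cutoff has twice its width, hence \<open>\<delta> / 8\<close>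
    for the claimed \<open>\<delta> / 4\<close>.\<close>
  have \<delta>8: "0 < \<delta> / 8" "\<delta> / 8 \<le> 1"
    using \<delta> by auto
  note wE = weight_cutoff[OF \<delta>8 E'(2)]
  define g where "g = lip0_mult (cutoff (\<delta> / 8) E') k"
  have g_apply: "lip0_apply g x = cutoff (\<delta> / 8) E' x * lip0_apply k x" for x
    by (simp add: g_def lip0_apply_mult[OF wE])
  show thesis
  proof (rule that)
    show "N \<le> n" "\<bar>blinfun_apply (\<mu> n) P\<bar> \<le> \<epsilon> / 2"
      using n N'[of n] by auto
    show "finite E'" "E \<subseteq> E'" by fact+
    show "\<mu> n \<in> span (lip0_eval ` E')"
      using S(2)[of n] span_mono[OF image_mono[OF E'(4)]] by blast
    have "blinfun_apply (\<mu> n) g = blinfun_apply (\<mu> n) k"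
    proof (rule span_lip0_eval_cong[OF S(2)])
      fix x assume "x \<in> S n"
      then have "infdist x E' = 0"
        using E'(4) by auto
      then show "lip0_apply g x = lip0_apply k x"
        using \<delta> by (simp add: g_apply cutoff_eq_1)
    qed
    with k show "\<epsilon> < blinfun_apply (\<mu> n) g" by simp
    have "norm g \<le> (1 + 2 / (\<delta> / 8)) * norm k"
      unfolding g_def by (rule norm_lip0_mult_le[OF wE])
    also have "\<dots> = (1 + 16 / \<delta>) * norm k"
      by simp
    also have "\<dots> \<le> (1 + 16 / \<delta>) * (1 + 2 / \<delta>)"
      using \<delta> k by (intro mult_left_mono) auto
    finally show "norm g \<le> (1 + 16 / \<delta>) * (1 + 2 / \<delta>)" .
    show "\<forall>x. infdist x E \<le> \<delta> * dist x 0 \<longrightarrow> lip0_apply g x = 0"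
    proof (intro allI impI)
      fix x assume "infdist x E \<le> \<delta> * dist x 0"
      moreover have "infdist x A \<le> infdist x E"
        using A E by (intro infdist_mono) auto
      ultimately show "lip0_apply g x = 0"
        by (simp add: g_apply k0)
    qed
    show "\<forall>x. lip0_apply g x \<noteq> 0 \<longrightarrow> infdist x E' \<le> \<delta> / 4 * dist x 0"
      using infdist_le_of_cutoff[OF \<delta>8(1) E'(2)] by (auto simp: g_apply)
  qed
qed

text \<open>\<open>y\<close> is far from \<open>E\<close> and \<open>x\<close> is close to it, so
  \<open>dist y 0\<close> is at most a multiple of \<open>dist x y\<close>, and then so is
  \<open>dist x 0\<close>. This controls the jump between two humps, whose values are bounded by
  multiples of the distance to the base point.\<close>

lemma dist_separated:
  assumes \<delta>: "0 < \<delta>" "\<delta> \<le> 1"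
    and x: "infdist x E \<le> \<delta> / 4 * dist x 0" and y: "\<delta> * dist y 0 < infdist y E"
  shows "dist x 0 + dist y 0 \<le> (1 + 4 / \<delta>) * dist x y"
proof -
  have "infdist y E \<le> infdist x E + dist x y"
    using infdist_triangle[of y E x] by (simp add: dist_commute)
  moreover have xy: "dist x 0 \<le> dist y 0 + dist x y"
    using dist_triangle[of x 0 y] by (simp add: dist_commute)
  then have "\<delta> / 4 * dist x 0 \<le> \<delta> / 4 * (dist y 0 + dist x y)"
    using \<delta> by (intro mult_left_mono) auto
  moreover have "\<delta> * dist x y \<le> 1 * dist x y"
    using \<delta> by (intro mult_right_mono) auto
  ultimately have "3 * (\<delta> * dist y 0) \<le> 5 * dist x y"
    using x y by (simp add: algebra_simps)
  then have "\<delta> * dist y 0 \<le> 2 * dist x y"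
    using zero_le_dist[of x y] by linarith
  then have "dist y 0 \<le> 2 / \<delta> * dist x y"
    using \<delta> by (simp add: field_simps)
  moreover have "(1 + 4 / \<delta>) * dist x y = dist x y + 2 * (2 / \<delta> * dist x y)"
    by (simp add: algebra_simps)
  ultimately show ?thesis
    using xy by linarith
qed

text \<open>The contradiction comes from pairing with the sum \<open>G\<close> of all humps: at
  stage \<open>k\<close> the new hump contributes more than \<open>\<epsilon>\<close>, the earlier
  ones at most \<open>\<epsilon> / 2\<close> in absolute value, and the later ones vanish on the
  support.\<close>

lemma weakly_null_tight:
  fixes \<mu> :: "nat \<Rightarrow> 'a::{metric_space,zero} lip0 \<Rightarrow>\<^sub>L real"
  assumes span: "\<And>n. \<mu> n \<in> span (range lip0_eval)"
    and null: "\<And>f. (\<lambda>n. blinfun_apply (\<mu> n) f) \<longlonglongrightarrow> 0"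
    and \<epsilon>: "0 < \<epsilon>" and \<delta>: "0 < \<delta>" "\<delta> \<le> 1"
  shows "\<exists>E. finite E \<and> 0 \<in> E \<and> (\<forall>n. norm (weigh (\<lambda>x. 1 - cutoff \<delta> E x) (\<mu> n)) \<le> \<epsilon>)"
proof (rule ccontr)
  assume "\<not> ?thesis"
  then have not_tight:
    "\<forall>E. finite E \<and> 0 \<in> E \<longrightarrow> (\<exists>n. \<epsilon> < norm (weigh (\<lambda>x. 1 - cutoff \<delta> E x) (\<mu> n)))"
    by (auto simp: not_le)
  define C where "C = (1 + 16 / \<delta>) * (1 + 2 / \<delta>)"
  define step where "step k E P n E' g \<longleftrightarrow> k \<le> n \<and> E \<subseteq> E' \<and> \<mu> n \<in> span (lip0_eval ` E') \<and>
      \<bar>blinfun_apply (\<mu> n) P\<bar> \<le> \<epsilon> / 2 \<and> \<epsilon> < blinfun_apply (\<mu> n) g \<and> norm g \<le> C \<and>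
      (\<forall>x. infdist x E \<le> \<delta> * dist x 0 \<longrightarrow> lip0_apply g x = 0) \<and>
      (\<forall>x. lip0_apply g x \<noteq> 0 \<longrightarrow> infdist x E' \<le> \<delta> / 4 * dist x 0)" for k E P n E' g
  \<comment> \<open>The recursion state is a pair: the set of used points and the sum of the humps
    so far. The clause for \<open>k = 0\<close> records that this sum starts at 0.\<close>
  have "\<exists>F :: nat \<Rightarrow> 'a set \<times> 'a lip0. \<forall>k. (finite (fst (F k)) \<and> 0 \<in> fst (F k) \<and> (k = 0 \<longrightarrow> snd (F k) = 0)) \<and>
      (\<exists>n g. step k (fst (F k)) (snd (F k)) n (fst (F (Suc k))) g \<and> snd (F (Suc k)) = snd (F k) + g)"
  proof (rule dependent_nat_choice)
    show "\<exists>x::'a set \<times> 'a lip0. finite (fst x) \<and> 0 \<in> fst x \<and> ((0::nat) = 0 \<longrightarrow> snd x = 0)"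
      by (rule exI[of _ "({0}, 0)"]) auto
  next
    fix x :: "'a set \<times> 'a lip0" and k :: nat
    assume "finite (fst x) \<and> 0 \<in> fst x \<and> (k = 0 \<longrightarrow> snd x = 0)"
    then have E: "finite (fst x) \<and> 0 \<in> fst x" by blast
    obtain n E' g where "k \<le> n" and E': "finite E'" "fst x \<subseteq> E'"
      and "\<mu> n \<in> span (lip0_eval ` E')"
      "\<bar>blinfun_apply (\<mu> n) (snd x)\<bar> \<le> \<epsilon> / 2" "\<epsilon> < blinfun_apply (\<mu> n) g" "norm g \<le> C"
      "\<forall>z. infdist z (fst x) \<le> \<delta> * dist z 0 \<longrightarrow> lip0_apply g z = 0"
      "\<forall>z. lip0_apply g z \<noteq> 0 \<longrightarrow> infdist z E' \<le> \<delta> / 4 * dist z 0"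
      unfolding C_def
      by (rule separated_hump[OF span null \<epsilon> \<delta> not_tight conjunct1[OF E] conjunct2[OF E],
            of k "snd x"])
    then have "step k (fst x) (snd x) n E' g"
      by (simp add: step_def)
    then show "\<exists>y. (finite (fst y) \<and> 0 \<in> fst y \<and> (Suc k = 0 \<longrightarrow> snd y = 0)) \<and>
        (\<exists>n g. step k (fst x) (snd x) n (fst y) g \<and> snd y = snd x + g)"
      using E E' by (intro exI[of _ "(E', snd x + g)"]) auto
  qed
  then obtain F :: "nat \<Rightarrow> 'a set \<times> 'a lip0" where
    F: "\<And>k. finite (fst (F k)) \<and> 0 \<in> fst (F k) \<and> (k = 0 \<longrightarrow> snd (F k) = 0)"
      "\<And>k. \<exists>n g. step k (fst (F k)) (snd (F k)) n (fst (F (Suc k))) g \<and> snd (F (Suc k)) = snd (F k) + g"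
    by blast
  define E P where "E k = fst (F k)" and "P k = snd (F k)" for k
  have "\<exists>n g. step k (E k) (P k) n (E (Suc k)) g \<and> P (Suc k) = P k + g" for k
    using F(2)[of k] by (simp add: E_def P_def)
  then obtain n g where st: "\<And>k. step k (E k) (P k) (n k) (E (Suc k)) (g k)"
    and P_Suc: "\<And>k. P (Suc k) = P k + g k"
    by metis
  have E0: "0 \<in> E k" for k
    using F(1) by (simp add: E_def)
  have E_mono: "E i \<subseteq> E j" if "i \<le> j" for i j
    using lift_Suc_mono_le[of E, OF _ that] st unfolding step_def by blast
  have g_zero: "lip0_apply (g k) x = 0" if "infdist x (E k) \<le> \<delta> * dist x 0" for k x
    using st[of k] that by (auto simp: step_def)
  have g_supp: "infdist x (E j) \<le> \<delta> / 4 * dist x 0"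
    if "lip0_apply (g i) x \<noteq> 0" "i < j" for i j x
  proof -
    have "infdist x (E j) \<le> infdist x (E (Suc i))"
      using E_mono[of "Suc i" j] E0[of "Suc i"] that by (intro infdist_mono) auto
    also have "\<dots> \<le> \<delta> / 4 * dist x 0"
      using st[of i] that by (auto simp: step_def)
    finally show ?thesis .
  qed
  have sep: "dist x 0 + dist y 0 \<le> (1 + 4 / \<delta>) * dist x y"
    if "lip0_apply (g i) x \<noteq> 0" "lip0_apply (g j) y \<noteq> 0" "i \<noteq> j" for i j x y
  proof (cases "i < j")
    case True
    have "\<delta> * dist y 0 < infdist y (E j)"
      using g_zero[of y j] that by force
    from dist_separated[OF \<delta> g_supp[OF that(1) True] this] show ?thesis .
  next
    case False
    then have "j < i" using that by simp
    have "\<delta> * dist x 0 < infdist x (E i)"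
      using g_zero[of x i] that by force
    from dist_separated[OF \<delta> g_supp[OF that(2) \<open>j < i\<close>] this] show ?thesis
      by (simp add: dist_commute add.commute)
  qed
  have disj: "i = j" if "lip0_apply (g i) x \<noteq> 0" "lip0_apply (g j) x \<noteq> 0" for i j x
  proof (rule ccontr)
    assume "i \<noteq> j"
    \<comment> \<open>With both points equal to \<open>x\<close>, separation forces
      \<open>dist x 0 + dist x 0 \<le> 0\<close>.\<close>
    from sep[OF that this] have "x = 0" by simp
    with that show False by simp
  qed
  \<comment> \<open>At most one hump is nonzero at each point, so choosing it gives the pointwise
    sum of the infinite family without a series.\<close>
  define G where "G x = (if \<exists>k. lip0_apply (g k) x \<noteq> 0
      then lip0_apply (g (SOME k. lip0_apply (g k) x \<noteq> 0)) x else 0)" for x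
  have G_eq: "G x = lip0_apply (g k) x" if "lip0_apply (g k) x \<noteq> 0" for k x
    using disj[OF that someI[of "\<lambda>k. lip0_apply (g k) x \<noteq> 0", OF that]] that by (auto simp: G_def)
  have G_0: "G x = 0" if "\<And>k. lip0_apply (g k) x = 0" for x
    using that by (simp add: G_def)
  have C: "0 \<le> C"
    using \<delta> by (simp add: C_def)
  have gC: "norm (g k) \<le> C" for k
    using st[of k] by (simp add: step_def)
  have g_lip: "\<bar>lip0_apply (g k) x - lip0_apply (g k) y\<bar> \<le> C * dist x y" for k x y
    using lip0_dist_le[of "g k" x y] mult_right_mono[OF gC[of k] zero_le_dist[of x y]] by linarith
  have G_lip: "\<bar>G x - G y\<bar> \<le> C * (1 + 4 / \<delta>) * dist x y" for x y
  proof (cases "\<exists>i j. lip0_apply (g i) x \<noteq> 0 \<and> lip0_apply (g j) y \<noteq> 0 \<and> i \<noteq> j")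
    case True
    then obtain i j where ij: "lip0_apply (g i) x \<noteq> 0" "lip0_apply (g j) y \<noteq> 0" "i \<noteq> j"
      by blast
    have "\<bar>G x - G y\<bar> \<le> C * dist x 0 + C * dist y 0"
      using g_lip[of i x 0] g_lip[of j y 0] by (simp add: G_eq[OF ij(1)] G_eq[OF ij(2)])
    also have "\<dots> = C * (dist x 0 + dist y 0)"
      by (simp add: algebra_simps)
    also have "\<dots> \<le> C * ((1 + 4 / \<delta>) * dist x y)"
      by (intro mult_left_mono sep[OF ij] C)
    finally show ?thesis by simp
  next
    case False
    \<comment> \<open>No two distinct humps are active at \<open>x\<close> and \<open>y\<close>, so
      a single hump represents \<open>G\<close> at both points and its own Lipschitz bound
      applies.\<close>
    have "\<exists>k. G x = lip0_apply (g k) x \<and> G y = lip0_apply (g k) y"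
    proof (cases "\<exists>k. lip0_apply (g k) x \<noteq> 0 \<or> lip0_apply (g k) y \<noteq> 0")
      case True
      then obtain k where "lip0_apply (g k) x \<noteq> 0 \<or> lip0_apply (g k) y \<noteq> 0" ..
      with False show ?thesis
        by (intro exI[of _ k]) (metis G_0 G_eq)
    qed (auto simp: G_0)
    then have "\<bar>G x - G y\<bar> \<le> C * dist x y"
      using g_lip by metis
    also have "\<dots> \<le> C * dist x y + C * (4 / \<delta>) * dist x y"
      using C \<delta> by simp
    finally show ?thesis by (simp add: algebra_simps)
  qed
  have "G 0 = 0"
    by (simp add: G_0)
  then have Lip0_G: "lip0_apply (Lip0 G) = G"
    using C \<delta> by (intro lip0_apply_Lip0[OF _ G_lip]) auto
  have P_apply: "lip0_apply (P k) x = (\<Sum>i<k. lip0_apply (g i) x)" for k x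
    using F(1)[of 0] by (induction k) (auto simp: P_Suc P_def[of 0])
  have "\<epsilon> / 2 \<le> blinfun_apply (\<mu> (n k)) (Lip0 G)" for k
  proof -
    have "blinfun_apply (\<mu> (n k)) (Lip0 G) = blinfun_apply (\<mu> (n k)) (P (Suc k))"
    proof (rule span_lip0_eval_cong)
      show "\<mu> (n k) \<in> span (lip0_eval ` E (Suc k))"
        using st[of k] by (simp add: step_def)
      fix x assume x: "x \<in> E (Suc k)"
      have late: "lip0_apply (g i) x = 0" if "\<not> i < Suc k" for i
      proof (rule g_zero)
        have "x \<in> E i"
          using E_mono[of "Suc k" i] that x by auto
        then show "infdist x (E i) \<le> \<delta> * dist x 0"
          using \<delta> by simp
      qed
      have "G x = (\<Sum>i<Suc k. lip0_apply (g i) x)"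
      proof (cases "\<exists>j. lip0_apply (g j) x \<noteq> 0")
        case True
        then obtain j where j: "lip0_apply (g j) x \<noteq> 0" ..
        then have "j < Suc k"
          using late by blast
        then have "(\<Sum>i<Suc k. lip0_apply (g i) x) = (\<Sum>i\<in>{j}. lip0_apply (g i) x)"
          using disj[OF j] by (intro sum.mono_neutral_right) auto
        then show ?thesis
          by (simp add: G_eq[OF j])
      qed (auto simp: G_0)
      then show "lip0_apply (Lip0 G) x = lip0_apply (P (Suc k)) x"
        by (simp add: Lip0_G P_apply[of "Suc k"])
    qed
    also have "\<dots> \<ge> \<epsilon> / 2"
      using st[of k] by (auto simp: step_def P_Suc blinfun.add_right)
    finally show ?thesis .
  qed
  \<comment> \<open>The indices \<open>n k\<close> need not increase, but \<open>k \<le> n k\<close>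
    sends them to infinity.\<close>
  moreover have "(\<lambda>k. blinfun_apply (\<mu> (n k)) (Lip0 G)) \<longlonglongrightarrow> 0"
  proof (rule filterlim_compose[OF null])
    show "filterlim n sequentially sequentially"
      using st by (intro filterlim_at_top_mono[OF filterlim_ident]) (auto simp: step_def)
  qed
  ultimately have "\<epsilon> / 2 \<le> 0"
    by (intro LIMSEQ_le_const) auto
  with \<epsilon> show False by simp
qed

section \<open>Compact reduction\<close>

lemma weight_prod:
  assumes "\<And>i::nat. weight (C i) (h i)"
  shows "weight (\<Sum>i<k. C i) (\<lambda>x. \<Prod>i<k. h i x)"
proof (induction k)
  case (Suc k)
  show ?case
    using weight_mult[OF Suc assms[of k]] by simp
qed (simp add: weight_1)

text \<open>Since \<open>\<delta> 0 \<le> 1 / 2\<close>, closeness to the finite set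
  \<open>E 0\<close> bounds \<open>dist x 0\<close>. The relative widths then become absolute ones
  tending to 0, so \<open>E k\<close> is an \<open>e\<close>-net for large \<open>k\<close>. A
  closed totally bounded set in a complete space is compact.\<close>

lemma compact_relative_neighbourhoods:
  fixes E :: "nat \<Rightarrow> 'a::{complete_space,zero} set"
  assumes E: "\<And>k. finite (E k)" "\<And>k. 0 \<in> E k"
    and \<delta>: "\<delta> \<longlonglongrightarrow> (0::real)" "\<And>k. 0 \<le> \<delta> k" "\<delta> 0 \<le> 1 / 2"
  shows "compact {x. \<forall>k. infdist x (E k) \<le> \<delta> k * dist x 0}"
    (is "compact ?K")
proof -
  have "closed ?K"
    by (intro closed_Collect_all closed_Collect_le continuous_intros)
  obtain R where R: "\<And>e. e \<in> E 0 \<Longrightarrow> dist e 0 \<le> R"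
    using finite_imp_bounded[OF E(1)[of 0]] by (metis bounded_any_center dist_commute)
  have attained: "\<exists>e\<in>E k. dist x e \<le> \<delta> k * dist x 0" if "x \<in> ?K" for x k
  proof -
    have "infdist x (E k) = Min (dist x ` E k)"
      using E[of k] by (subst infdist_notempty) (auto intro!: cInf_eq_Min)
    also have "\<dots> \<in> dist x ` E k"
      using E[of k] by (intro Min_in) auto
    finally obtain e where "e \<in> E k" "infdist x (E k) = dist x e"
      by blast
    moreover have "infdist x (E k) \<le> \<delta> k * dist x 0"
      using that by blast
    ultimately show ?thesis by (intro bexI[of _ e]) simp_all
  qed
  have bd: "dist x 0 \<le> 2 * R" if x: "x \<in> ?K" for x
  proof -
    obtain e where e: "e \<in> E 0" "dist x e \<le> \<delta> 0 * dist x 0"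
      using attained[OF x] by blast
    have "dist x 0 \<le> dist x e + dist e 0"
      by (rule dist_triangle)
    also have "\<dots> \<le> 1 / 2 * dist x 0 + R"
      using e R mult_right_mono[OF \<delta>(3) zero_le_dist[of x 0]] by fastforce
    finally show ?thesis by simp
  qed
  have R0: "0 \<le> R"
    using R[OF E(2)] by simp
  have "\<exists>A. finite A \<and> ?K \<subseteq> (\<Union>x\<in>A. ball x e)" if e: "0 < e" for e
  proof -
    have "(\<lambda>k. \<delta> k * (2 * R)) \<longlonglongrightarrow> 0 * (2 * R)"
      by (intro tendsto_intros \<delta>)
    then have "eventually (\<lambda>k. \<delta> k * (2 * R) < e) sequentially"
      using e by (intro order_tendstoD(2)[of _ "0::real"]) auto
    then obtain k where k: "\<delta> k * (2 * R) < e"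
      by (auto simp: eventually_sequentially)
    have "?K \<subseteq> (\<Union>x\<in>E k. ball x e)"
    proof
      fix x assume x: "x \<in> ?K"
      obtain a where a: "a \<in> E k" "dist x a \<le> \<delta> k * dist x 0"
        using attained[OF x] by blast
      then have "dist x a < e"
        using mult_left_mono[OF bd[OF x] \<delta>(2)[of k]] k by linarith
      with a show "x \<in> (\<Union>x\<in>E k. ball x e)"
        by (auto simp: dist_commute)
    qed
    with E show ?thesis by blast
  qed
  then show ?thesis
    unfolding compact_eq_totally_bounded
    using \<open>closed ?K\<close> complete_eq_closed by blast
qed

text \<open>The partial products \<open>g k\<close> of cutoffs converge pointwise, and
  \<open>weigh (g k) (\<mu> n)\<close> converges to \<open>y n\<close> at a rate uniform in
  \<open>n\<close>. The uniformity carries weak nullness over to \<open>y\<close>.\<close>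

lemma compact_reduction:
  fixes \<mu> :: "nat \<Rightarrow> 'a::{complete_space,zero} lip0 \<Rightarrow>\<^sub>L real"
  assumes span: "\<And>n. \<mu> n \<in> span (range lip0_eval)"
    and null: "\<And>f. (\<lambda>n. blinfun_apply (\<mu> n) f) \<longlonglongrightarrow> 0"
    and \<epsilon>: "0 < \<epsilon>"
  obtains K y where "compact K" "\<forall>n. y n \<in> span (lip0_eval ` K)"
    "\<forall>n. norm (\<mu> n - y n) \<le> \<epsilon>" "\<forall>f. (\<lambda>n. blinfun_apply (y n) f) \<longlonglongrightarrow> 0"
proof -
  \<comment> \<open>The shift by 2 makes the doubled first width equal to the 1/2 allowed for
    compactness.\<close>
  define \<delta> :: "nat \<Rightarrow> real" where "\<delta> k = (1/2) ^ (k + 2)" for k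
  define C where "C k = (\<Sum>i<k. 2 / \<delta> i)" for k
  \<comment> \<open>\<open>1 + C k\<close> bounds the norm of \<open>weigh (g k)\<close>, so the
    \<open>k\<close>-th cutoff will change the weighted element by at most
    \<open>\<epsilon> * (1/2) ^ Suc k\<close>, and all cutoffs together by at most
    \<open>\<epsilon>\<close>.\<close>
  define \<eta> where "\<eta> k = \<epsilon> * (1/2) ^ Suc k / (1 + C k)" for k
  have \<delta>: "0 < \<delta> k" "\<delta> k \<le> 1" for k
    unfolding \<delta>_def by (simp, rule power_le_one) auto
  have C: "0 \<le> C k" for k
    unfolding C_def using \<delta> by (intro sum_nonneg) (simp add: less_imp_le)
  have \<eta>: "0 < \<eta> k" for k
    using \<epsilon> C[of k] by (simp add: \<eta>_def add_pos_nonneg)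
  have "\<forall>k. \<exists>E. finite E \<and> 0 \<in> E \<and> (\<forall>n. norm (weigh (\<lambda>x. 1 - cutoff (\<delta> k) E x) (\<mu> n)) \<le> \<eta> k)"
    using weakly_null_tight[OF span null \<eta> \<delta>] by blast
  then obtain E where E: "\<And>k. finite (E k)" "\<And>k. 0 \<in> E k"
    and E_le: "\<And>k n. norm (weigh (\<lambda>x. 1 - cutoff (\<delta> k) (E k) x) (\<mu> n)) \<le> \<eta> k"
    by metis
  define h where "h k = cutoff (\<delta> k) (E k)" for k
  define g where "g k x = (\<Prod>i<k. h i x)" for k x
  have wh: "weight (2 / \<delta> k) (h k)" for k
    unfolding h_def by (intro weight_cutoff \<delta> E)
  have wg: "weight (C k) (g k)" for k
    unfolding g_def C_def by (rule weight_prod[OF wh])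
  define K where "K = {x. \<forall>k. infdist x (E k) \<le> (2 * \<delta> k) * dist x 0}"
  have "compact K"
    unfolding K_def
  proof (rule compact_relative_neighbourhoods[OF E])
    have "(\<lambda>k. 2 * ((1/2) ^ k * (1/2)\<^sup>2)) \<longlonglongrightarrow> 2 * (0 * (1/2::real)\<^sup>2)"
      by (intro tendsto_intros LIMSEQ_realpow_zero) auto
    then show "(\<lambda>k. 2 * \<delta> k) \<longlonglongrightarrow> 0"
      by (simp add: \<delta>_def power_add)
  qed (use \<delta> in \<open>auto simp: less_imp_le \<delta>_def[of 0] power2_eq_square\<close>)
  have off_K: "(\<lambda>k. g k x) \<longlonglongrightarrow> 0" if x: "x \<notin> K" for x
  proof -
    obtain i where "\<not> infdist x (E i) \<le> 2 * \<delta> i * dist x 0"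
      using x unfolding K_def by blast
    then have "h i x = 0"
      using infdist_le_of_cutoff[OF \<delta>(1) E(2)] unfolding h_def by blast
    then have "g k x = 0" if "Suc i \<le> k" for k
      using that by (auto simp: g_def intro!: prod_zero)
    then show ?thesis
      by (intro tendsto_eventually eventually_sequentiallyI[of "Suc i"]) auto
  qed
  have "convergent (\<lambda>k. g k x)" for x
  proof -
    have "decseq (\<lambda>k. g k x)"
      by (rule decseq_SucI)
        (simp add: g_def mult_left_le prod_nonneg weight_ge_0[OF wh] weight_le_1[OF wh])
    then show ?thesis
      using decseq_convergent[of "\<lambda>k. g k x" 0] weight_ge_0[OF wg] by (metis convergentI)
  qed
  then have g_lim: "(\<lambda>k. g k x) \<longlonglongrightarrow> lim (\<lambda>k. g k x)" for x
    by (simp add: convergent_LIMSEQ_iff)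
  \<comment> \<open>By linearity it suffices to treat point masses, whose coefficients converge to
    \<open>lim (\<lambda>k. g k x)\<close>. This is 0 off \<open>K\<close>, so the limit is again a
    finite combination, now over \<open>K\<close>.\<close>
  have "\<exists>y\<in>span (lip0_eval ` K). (\<lambda>k. weigh (g k) \<gamma>) \<longlonglongrightarrow> y" if "\<gamma> \<in> span (range lip0_eval)" for \<gamma>
    using that
  proof (induction rule: span_induct_alt)
    case base
    show ?case
      by (intro bexI[of _ 0]) (auto simp: weigh_zero span_zero)
  next
    case (step c u \<gamma>)
    then obtain x y where u: "u = lip0_eval x" and y: "y \<in> span (lip0_eval ` K)"
      "(\<lambda>k. weigh (g k) \<gamma>) \<longlonglongrightarrow> y"
      by blast
    have eq: "weigh (g k) (c *\<^sub>R u + \<gamma>) = c *\<^sub>R (g k x *\<^sub>R u) + weigh (g k) \<gamma>" for k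
      by (simp add: weigh_add weigh_scaleR u weigh_lip0_eval[OF wg])
    have "lim (\<lambda>k. g k x) *\<^sub>R u \<in> span (lip0_eval ` K)"
      using off_K[of x] limI[of "\<lambda>k. g k x" 0]
      by (cases "x \<in> K") (auto simp: u intro: span_scale span_base span_zero)
    then have "c *\<^sub>R (lim (\<lambda>k. g k x) *\<^sub>R u) + y \<in> span (lip0_eval ` K)"
      by (rule span_add[OF span_scale y(1)])
    then show ?case
      unfolding eq by (rule bexI[rotated]) (intro tendsto_intros g_lim y)
  qed
  from this[OF span] have "\<exists>y. y \<in> span (lip0_eval ` K) \<and> (\<lambda>k. weigh (g k) (\<mu> n)) \<longlonglongrightarrow> y" for n
    by blast
  then obtain y where y_span: "\<And>n. y n \<in> span (lip0_eval ` K)"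
    and y_lim: "\<And>n. (\<lambda>k. weigh (g k) (\<mu> n)) \<longlonglongrightarrow> y n"
    by metis
  have "norm (weigh (g k) (\<mu> n) - weigh (g (Suc k)) (\<mu> n)) \<le> \<epsilon> * (1/2) ^ Suc k" for k n
  proof -
    have "g (Suc k) = (\<lambda>x. g k x * h k x)"
      by (simp add: g_def fun_eq_iff)
    then have "weigh (g (Suc k)) (\<mu> n) = weigh (g k) (weigh (h k) (\<mu> n))"
      by (simp add: weigh_weigh[OF wg wh])
    \<comment> \<open>Passing from \<open>g k\<close> to \<open>g (Suc k)\<close> removes what
      \<open>h k\<close> cuts away, which tightness makes small before \<open>weigh (g k)\<close> is
      applied.\<close>
    then have "weigh (g k) (\<mu> n) - weigh (g (Suc k)) (\<mu> n)
        = weigh (g k) (weigh (\<lambda>x. 1 - h k x) (\<mu> n))"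
      by (simp add: weigh_compl[OF wh] weigh_diff)
    also have "norm \<dots> \<le> (1 + C k) * norm (weigh (\<lambda>x. 1 - h k x) (\<mu> n))"
      by (rule norm_weigh_le[OF wg])
    also have "\<dots> \<le> (1 + C k) * \<eta> k"
      using C E_le by (intro mult_left_mono) (auto simp: h_def)
    also have "\<dots> = \<epsilon> * (1/2) ^ Suc k"
      unfolding \<eta>_def times_divide_eq_right
      by (rule nonzero_mult_div_cancel_left) (use C[of k] in linarith)
    finally show ?thesis .
  qed
  note step = this
  have "norm (weigh (g k) (\<mu> n) - weigh (g (k + j)) (\<mu> n)) \<le> \<epsilon> * ((1/2) ^ k - (1/2) ^ (k + j))" for k j n
  proof (induction j)
    case (Suc j)
    have "norm (weigh (g k) (\<mu> n) - weigh (g (k + Suc j)) (\<mu> n))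
        \<le> norm (weigh (g k) (\<mu> n) - weigh (g (k + j)) (\<mu> n))
          + norm (weigh (g (k + j)) (\<mu> n) - weigh (g (Suc (k + j))) (\<mu> n))"
      using norm_triangle_ineq[of "weigh (g k) (\<mu> n) - weigh (g (k + j)) (\<mu> n)"
          "weigh (g (k + j)) (\<mu> n) - weigh (g (Suc (k + j))) (\<mu> n)"] by simp
    with Suc step[where k = "k + j" and n = n] show ?case
      by (simp add: algebra_simps)
  qed simp
  then have near: "norm (weigh (g k) (\<mu> n) - weigh (g (k + j)) (\<mu> n)) \<le> \<epsilon> * (1/2) ^ k" for k j n
    by (rule order_trans) (use \<epsilon> in \<open>simp add: right_diff_distrib\<close>)
  have close: "norm (weigh (g k) (\<mu> n) - y n) \<le> \<epsilon> * (1/2) ^ k" for k n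
  proof -
    have "(\<lambda>j. norm (weigh (g k) (\<mu> n) - weigh (g (j + k)) (\<mu> n))) \<longlonglongrightarrow> norm (weigh (g k) (\<mu> n) - y n)"
      by (rule tendsto_norm[OF tendsto_diff[OF tendsto_const LIMSEQ_ignore_initial_segment[OF y_lim]]])
    then show ?thesis
      by (rule LIMSEQ_le_const2) (intro exI allI impI, subst add.commute[of _ k], rule near)
  qed
  show thesis
  proof (rule that[OF \<open>compact K\<close>])
    show "\<forall>n. y n \<in> span (lip0_eval ` K)"
      using y_span by blast
    have "g 0 = (\<lambda>_. 1)"
      by (simp add: g_def fun_eq_iff)
    then show "\<forall>n. norm (\<mu> n - y n) \<le> \<epsilon>"
      using close[of 0] by (simp add: weigh_1)
    show "\<forall>f. (\<lambda>n. blinfun_apply (y n) f) \<longlonglongrightarrow> 0"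
    proof (intro allI LIMSEQ_I)
      fix f :: "'a lip0" and e :: real assume e: "0 < e"
      \<comment> \<open>\<open>k\<close> is chosen from \<open>f\<close> and \<open>e\<close> alone
        and serves all \<open>n\<close> by \<open>close\<close>; only then is \<open>n\<close> taken
        large, for the fixed test function \<open>lip0_mult (g k) f\<close>.\<close>
      have "(\<lambda>k. \<epsilon> * (1/2) ^ k * norm f) \<longlonglongrightarrow> \<epsilon> * 0 * norm f"
        by (intro tendsto_intros LIMSEQ_realpow_zero) auto
      then have "eventually (\<lambda>k. \<epsilon> * (1/2) ^ k * norm f < e / 2) sequentially"
        using e by (intro order_tendstoD(2)[of _ "0::real"]) auto
      then obtain k where k: "\<epsilon> * (1/2) ^ k * norm f < e / 2"
        by (auto simp: eventually_sequentially)
      obtain N where N: "\<bar>blinfun_apply (\<mu> n) (lip0_mult (g k) f)\<bar> < e / 2" if "N \<le> n" for n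
        using LIMSEQ_D[OF null, of "e / 2"] e by auto
      show "\<exists>N. \<forall>n\<ge>N. norm (blinfun_apply (y n) f - 0) < e"
      proof (intro exI allI impI)
        fix n assume n: "N \<le> n"
        have "\<bar>blinfun_apply (weigh (g k) (\<mu> n) - y n) f\<bar> \<le> norm (weigh (g k) (\<mu> n) - y n) * norm f"
          using norm_blinfun[of "weigh (g k) (\<mu> n) - y n" f] by simp
        also have "\<dots> \<le> \<epsilon> * (1/2) ^ k * norm f"
          by (intro mult_right_mono close) simp
        finally show "norm (blinfun_apply (y n) f - 0) < e"
          using k N[OF n] by (simp add: blinfun.diff_left weigh_apply[OF wg])
      qed
    qed
  qed
qed

section \<open>Duals of subspaces\<close>

lemma dual_onI:
  assumes "\<And>x y. x \<in> X \<Longrightarrow> y \<in> X \<Longrightarrow> f (x + y) = f x + f y"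
    and "\<And>c x. x \<in> X \<Longrightarrow> f (c *\<^sub>R x) = c * f x"
    and "\<And>x. x \<in> X \<Longrightarrow> \<bar>f x\<bar> \<le> C * norm x"
    and "\<And>x. x \<notin> X \<Longrightarrow> f x = 0"
  shows "f \<in> dual_on X"
  unfolding dual_on_def using assms by blast

lemma dual_on_add: "f \<in> dual_on X \<Longrightarrow> x \<in> X \<Longrightarrow> y \<in> X \<Longrightarrow> f (x + y) = f x + f y"
  and dual_on_scaleR: "f \<in> dual_on X \<Longrightarrow> x \<in> X \<Longrightarrow> f (c *\<^sub>R x) = c * f x"
  and dual_on_outside: "f \<in> dual_on X \<Longrightarrow> x \<notin> X \<Longrightarrow> f x = 0"
  by (auto simp: dual_on_def)

lemma dual_on_diff:
  assumes "f \<in> dual_on X" and "subspace X" and "x \<in> X" and "y \<in> X"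
  shows "f (x - y) = f x - f y"
proof -
  have "f ((x - y) + y) = f (x - y) + f y"
    using assms by (intro dual_on_add subspace_diff)
  then show ?thesis by simp
qed

lemma dual_on_bounded:
  assumes "f \<in> dual_on X"
  obtains C where "0 \<le> C" "\<And>x. x \<in> X \<Longrightarrow> \<bar>f x\<bar> \<le> C * norm x"
proof -
  from assms obtain C where C: "\<And>x. x \<in> X \<Longrightarrow> \<bar>f x\<bar> \<le> C * norm x"
    unfolding dual_on_def by blast
  have "\<bar>f x\<bar> \<le> \<bar>C\<bar> * norm x" if "x \<in> X" for x
    using C[OF that] mult_right_mono[OF abs_ge_self[of C] norm_ge_zero[of x]] by linarith
  then show thesis
    using that[of "\<bar>C\<bar>"] by simp
qed

lemma dual_on_fun_add:
  assumes "f \<in> dual_on X" and "g \<in> dual_on X"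
  shows "(\<lambda>x. f x + g x) \<in> dual_on X"
proof -
  obtain C D where "\<And>x. x \<in> X \<Longrightarrow> \<bar>f x\<bar> \<le> C * norm x" "\<And>x. x \<in> X \<Longrightarrow> \<bar>g x\<bar> \<le> D * norm x"
    using assms dual_on_bounded by metis
  then have "\<bar>f x + g x\<bar> \<le> (C + D) * norm x" if "x \<in> X" for x
    using that by (fastforce simp: distrib_right)
  then show ?thesis
    using assms by (intro dual_onI[where C = "C + D"])
      (auto simp: dual_on_add dual_on_scaleR dual_on_outside algebra_simps)
qed

lemma dual_on_fun_scale:
  assumes "f \<in> dual_on X"
  shows "(\<lambda>x. c * f x) \<in> dual_on X"
proof -
  obtain C where "\<And>x. x \<in> X \<Longrightarrow> \<bar>f x\<bar> \<le> C * norm x"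
    using assms dual_on_bounded by metis
  then have "\<bar>c * f x\<bar> \<le> (\<bar>c\<bar> * C) * norm x" if "x \<in> X" for x
    using mult_left_mono[of "\<bar>f x\<bar>" "C * norm x" "\<bar>c\<bar>"] that by (simp add: abs_mult mult.assoc)
  then show ?thesis
    using assms by (intro dual_onI[where C = "\<bar>c\<bar> * C"])
      (auto simp: dual_on_add dual_on_scaleR dual_on_outside algebra_simps)
qed

lemma dual_norm_on_bdd_above:
  assumes "f \<in> dual_on X"
  shows "bdd_above ((\<lambda>x. \<bar>f x\<bar>) ` {x\<in>X. norm x \<le> 1})"
proof -
  obtain C where C: "0 \<le> C" "\<And>x. x \<in> X \<Longrightarrow> \<bar>f x\<bar> \<le> C * norm x"
    using dual_on_bounded[OF assms] by blast
  have "\<bar>f x\<bar> \<le> C" if "x \<in> X" "norm x \<le> 1" for x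
    using C(2)[OF that(1)] mult_left_mono[OF that(2) C(1)] by linarith
  then show ?thesis by (auto intro!: bdd_aboveI)
qed

lemma dual_norm_on_bound:
  assumes f: "f \<in> dual_on X" and X: "subspace X" and x: "x \<in> X"
  shows "\<bar>f x\<bar> \<le> dual_norm_on X f * norm x"
proof (cases "x = 0")
  case True
  then show ?thesis
    using dual_on_scaleR[OF f x, of 0] by simp
next
  case False
  have "\<bar>f ((1 / norm x) *\<^sub>R x)\<bar> \<le> dual_norm_on X f"
    unfolding dual_norm_on_def
    using False X x by (intro cSUP_upper[OF _ dual_norm_on_bdd_above[OF f]]) (auto intro: subspace_scale)
  then show ?thesis
    using False by (simp add: dual_on_scaleR[OF f x] abs_mult field_simps)
qed

lemma dual_norm_on_nonneg:
  assumes "f \<in> dual_on X" and "subspace X"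
  shows "0 \<le> dual_norm_on X f"
proof -
  have "\<bar>f 0\<bar> \<le> dual_norm_on X f"
    unfolding dual_norm_on_def
    by (intro cSUP_upper[OF _ dual_norm_on_bdd_above[OF assms(1)]])
      (auto intro: subspace_0[OF assms(2)])
  then show ?thesis by linarith
qed

section \<open>Restriction of functionals to a smaller subspace\<close>

text \<open>The value 0 off \<open>Y\<close> is the normalisation that \<open>dual_on\<close>
  demands.\<close>

definition restrict_dual :: "'b set \<Rightarrow> ('b \<Rightarrow> real) \<Rightarrow> 'b \<Rightarrow> real" where
  "restrict_dual Y f x = (if x \<in> Y then f x else 0)"

lemma restrict_dual_in:
  assumes "f \<in> dual_on X" and "subspace Y" and "Y \<subseteq> X"
  shows "restrict_dual Y f \<in> dual_on Y"
proof -
  obtain C where "\<And>x. x \<in> X \<Longrightarrow> \<bar>f x\<bar> \<le> C * norm x"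
    using dual_on_bounded[OF assms(1)] by blast
  then show ?thesis
    using assms by (intro dual_onI[where C = C])
      (auto simp: restrict_dual_def subspace_add subspace_scale dual_on_def subset_iff)
qed

lemma dual_norm_restrict_le:
  assumes "f \<in> dual_on X" and "subspace Y" and "Y \<subseteq> X"
  shows "dual_norm_on Y (restrict_dual Y f) \<le> dual_norm_on X f"
  unfolding dual_norm_on_def
proof (rule cSUP_mono[OF _ dual_norm_on_bdd_above[OF assms(1)]])
  show "{x \<in> Y. norm x \<le> 1} \<noteq> {}"
    using subspace_0[OF assms(2)] by auto
  fix x assume "x \<in> {x \<in> Y. norm x \<le> 1}"
  then show "\<exists>z\<in>{x \<in> X. norm x \<le> 1}. \<bar>restrict_dual Y f x\<bar> \<le> \<bar>f z\<bar>"
    using assms(3) by (intro bexI[of _ x]) (auto simp: restrict_dual_def)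
qed

text \<open>Restriction is a linear contraction between the duals, so composing with it turns a
  bidual element over \<open>Y\<close> into one over \<open>X\<close>.\<close>

lemma dual_weakly_null_restrict:
  assumes f: "dual_weakly_null_on X f" and X: "subspace X" and Y: "subspace Y" "Y \<subseteq> X"
  shows "dual_weakly_null_on Y (\<lambda>n. restrict_dual Y (f n))"
  unfolding dual_weakly_null_on_def
proof (intro conjI allI ballI)
  have fX: "f n \<in> dual_on X" for n
    using f by (simp add: dual_weakly_null_on_def)
  show "restrict_dual Y (f n) \<in> dual_on Y" for n
    by (rule restrict_dual_in[OF fX Y])
  fix \<phi> assume \<phi>: "\<phi> \<in> bidual_on Y"
  define \<psi> where "\<psi> f = (if f \<in> dual_on X then \<phi> (restrict_dual Y f) else 0)" for f
  have r_add: "restrict_dual Y (\<lambda>x. f x + g x) = (\<lambda>x. restrict_dual Y f x + restrict_dual Y g x)"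
    for f g :: "'a \<Rightarrow> real"
    by (auto simp: restrict_dual_def)
  have r_scale: "restrict_dual Y (\<lambda>x. c * f x) = (\<lambda>x. c * restrict_dual Y f x)"
    for f :: "'a \<Rightarrow> real" and c
    by (auto simp: restrict_dual_def)
  obtain C where C: "\<And>f. f \<in> dual_on Y \<Longrightarrow> \<bar>\<phi> f\<bar> \<le> C * dual_norm_on Y f"
    using \<phi> unfolding bidual_on_def by blast
  have "\<bar>\<psi> f\<bar> \<le> \<bar>C\<bar> * dual_norm_on X f" if "f \<in> dual_on X" for f
  proof -
    note rf = restrict_dual_in[OF that Y]
    have "\<bar>\<psi> f\<bar> \<le> C * dual_norm_on Y (restrict_dual Y f)"
      using C[OF rf] that by (simp add: \<psi>_def)
    also have "\<dots> \<le> \<bar>C\<bar> * dual_norm_on X f"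
      by (intro mult_mono dual_norm_restrict_le[OF that Y] dual_norm_on_nonneg[OF rf Y(1)]) auto
    finally show ?thesis .
  qed
  moreover have "\<psi> (\<lambda>x. f x + g x) = \<psi> f + \<psi> g" if "f \<in> dual_on X" "g \<in> dual_on X" for f g
    using \<phi> restrict_dual_in[OF that(1) Y] restrict_dual_in[OF that(2) Y] that
    by (simp add: \<psi>_def dual_on_fun_add r_add bidual_on_def)
  moreover have "\<psi> (\<lambda>x. c * f x) = c * \<psi> f" if "f \<in> dual_on X" for f c
    using \<phi> restrict_dual_in[OF that Y] that by (simp add: \<psi>_def dual_on_fun_scale r_scale bidual_on_def)
  ultimately have "\<psi> \<in> bidual_on X"
    unfolding bidual_on_def by (auto simp: \<psi>_def)
  then have "(\<lambda>n. \<psi> (f n)) \<longlonglongrightarrow> 0"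
    using f by (simp add: dual_weakly_null_on_def)
  then show "(\<lambda>n. \<phi> (restrict_dual Y (f n))) \<longlonglongrightarrow> 0"
    by (simp add: \<psi>_def fX)
qed

text \<open>Evaluation at \<open>x\<close> belongs to the bidual.\<close>

lemma dual_weakly_null_pointwise:
  assumes f: "dual_weakly_null_on X f" and X: "subspace X" and x: "x \<in> X"
  shows "(\<lambda>n. f n x) \<longlonglongrightarrow> 0"
proof -
  define \<psi> where "\<psi> g = (if g \<in> dual_on X then g x else 0)" for g :: "'a \<Rightarrow> real"
  have "\<bar>\<psi> g\<bar> \<le> norm x * dual_norm_on X g" if "g \<in> dual_on X" for g
    using dual_norm_on_bound[OF that X x] that by (simp add: \<psi>_def mult.commute)
  then have "\<psi> \<in> bidual_on X"
    unfolding bidual_on_def by (auto simp: \<psi>_def dual_on_fun_add dual_on_fun_scale)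
  then have "(\<lambda>n. \<psi> (f n)) \<longlonglongrightarrow> 0" and "\<And>n. f n \<in> dual_on X"
    using f by (simp_all add: dual_weakly_null_on_def)
  then show ?thesis
    by (simp add: \<psi>_def)
qed

text \<open>The gliding hump proof of Sokal: for every direction \<open>u\<close> one of \<open>x + u\<close>, \<open>x - u\<close> makes
  the functional at least as large as it is at \<open>u\<close>.\<close>

lemma uniform_boundedness_dual_on:
  fixes X :: "'b::banach set" and f :: "nat \<Rightarrow> 'b \<Rightarrow> real"
  assumes X: "subspace X" "closed X" and f: "\<And>n. f n \<in> dual_on X"
    and pointwise: "\<And>x. x \<in> X \<Longrightarrow> Bseq (\<lambda>n. f n x)"
  obtains C where "\<forall>n. \<forall>x\<in>X. \<bar>f n x\<bar> \<le> C * norm x"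
proof (cases "\<exists>C. \<forall>n. dual_norm_on X (f n) \<le> C")
  case True
  then obtain C where "\<And>n. dual_norm_on X (f n) \<le> C" by blast
  then have "\<bar>f n x\<bar> \<le> C * norm x" if "x \<in> X" for n x
    by (rule order_trans[OF dual_norm_on_bound[OF f X(1) that] mult_right_mono]) auto
  then show thesis by (intro that) blast
next
  case False
  \<comment> \<open>Norms beyond \<open>4 ^ k\<close> outgrow the step lengths
    \<open>(1/3) ^ k\<close> used below, leaving growth of order \<open>(4/3) ^ k\<close>.\<close>
  then have "\<forall>k::nat. \<exists>n. 4 ^ k < dual_norm_on X (f n)"
    by (meson not_le)
  then obtain n where n: "\<And>k::nat. 4 ^ k < dual_norm_on X (f (n k))"
    by metis
  define D where "D k = dual_norm_on X (f (n k))" for k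
  have D: "4 ^ k < D k" "0 < D k" for k
    using n[of k] less_trans[OF _ n[of k], of 0] by (auto simp: D_def)
  have "\<exists>u\<in>X. norm u \<le> 1 \<and> 2 / 3 * D k < \<bar>f (n k) u\<bar>" for k
  proof -
    have "2 / 3 * D k < (SUP x\<in>{x\<in>X. norm x \<le> 1}. \<bar>f (n k) x\<bar>)"
      using D(2)[of k] by (simp add: D_def dual_norm_on_def)
    then show ?thesis
      using subspace_0[OF X(1)]
      by (subst (asm) less_cSUP_iff[OF _ dual_norm_on_bdd_above[OF f]]) auto
  qed
  then obtain u where u: "\<And>k. u k \<in> X" "\<And>k. norm (u k) \<le> 1" "\<And>k. 2 / 3 * D k < \<bar>f (n k) (u k)\<bar>"
    by metis
  have "\<exists>x. \<forall>k. x k \<in> X \<and> (norm (x (Suc k) - x k) \<le> (1/3) ^ k \<and>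
      (1/3) ^ k * (2 / 3 * D k) \<le> \<bar>f (n k) (x (Suc k))\<bar>)"
  proof (rule dependent_nat_choice)
    show "\<exists>x. x \<in> X"
      using subspace_0[OF X(1)] by blast
  next
    fix x k assume x: "x \<in> X"
    define v where "v = (1/3) ^ k *\<^sub>R u k"
    have v: "v \<in> X"
      by (simp add: v_def u subspace_scale[OF X(1)])
    have "\<bar>f (n k) v\<bar> = (1/3) ^ k * \<bar>f (n k) (u k)\<bar>"
      by (simp add: v_def dual_on_scaleR[OF f u(1)] abs_mult)
    also have "\<dots> \<ge> (1/3) ^ k * (2 / 3 * D k)"
      using u(3)[of k] by (intro mult_left_mono) auto
    finally have fv: "(1/3) ^ k * (2 / 3 * D k) \<le> \<bar>f (n k) v\<bar>" .
    have "norm v \<le> (1/3) ^ k"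
      using u(2)[of k] by (simp add: v_def mult_left_le)
    \<comment> \<open>\<open>f (n k) v\<close> is half the difference of the values at
      \<open>x + v\<close> and \<open>x - v\<close>.\<close>
    moreover have "\<bar>f (n k) v\<bar> \<le> \<bar>f (n k) (x + v)\<bar> \<or> \<bar>f (n k) v\<bar> \<le> \<bar>f (n k) (x - v)\<bar>"
      by (simp add: dual_on_add[OF f x v] dual_on_diff[OF f X(1) x v]) linarith
    ultimately show "\<exists>y. y \<in> X \<and> norm (y - x) \<le> (1/3) ^ k \<and>
        (1/3) ^ k * (2 / 3 * D k) \<le> \<bar>f (n k) y\<bar>"
      using fv x v subspace_add[OF X(1)] subspace_diff[OF X(1)]
      by (elim disjE) (rule exI[of _ "x + v"], simp, rule exI[of _ "x - v"], simp)
  qed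
  then obtain x where x: "\<And>k. x k \<in> X" "\<And>k. norm (x (Suc k) - x k) \<le> (1/3) ^ k"
    "\<And>k. (1/3) ^ k * (2 / 3 * D k) \<le> \<bar>f (n k) (x (Suc k))\<bar>"
    by blast
  have "summable (\<lambda>k. x (Suc k) - x k)"
    by (rule summable_comparison_test'[where g = "\<lambda>k. (1/3) ^ k" and N = 0])
      (auto intro!: summable_geometric x)
  from summable_LIMSEQ[OF this] have "(\<lambda>k. x 0 + (\<Sum>i<k. x (Suc i) - x i)) \<longlonglongrightarrow> x 0 + (\<Sum>k. x (Suc k) - x k)"
    by (intro tendsto_intros)
  then obtain l where l: "x \<longlonglongrightarrow> l"
    by (auto simp: sum_lessThan_telescope)
  have lX: "l \<in> X"
    using closed_sequentially[OF X(2) _ l] x(1) by blast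
  have "norm (x (k + j) - x k) \<le> 3 / 2 * ((1/3) ^ k - (1/3) ^ (k + j))" for k j
  proof (induction j)
    case (Suc j)
    have "norm (x (k + Suc j) - x k) \<le> norm (x (Suc (k + j)) - x (k + j)) + norm (x (k + j) - x k)"
      using norm_triangle_ineq[of "x (Suc (k + j)) - x (k + j)" "x (k + j) - x k"] by simp
    also have "\<dots> \<le> (1/3) ^ (k + j) + 3 / 2 * ((1/3) ^ k - (1/3) ^ (k + j))"
      by (intro add_mono x Suc)
    finally show ?case by (simp add: algebra_simps)
  qed simp
  then have near: "norm (x (k + j) - x k) \<le> 3 / 2 * (1/3) ^ k" for k j
    by (rule order_trans) simp
  have tail: "norm (l - x k) \<le> 3 / 2 * (1/3) ^ k" for k
  proof -
    have "(\<lambda>j. norm (x (j + k) - x k)) \<longlonglongrightarrow> norm (l - x k)"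
      by (rule tendsto_norm[OF tendsto_diff[OF LIMSEQ_ignore_initial_segment[OF l] tendsto_const]])
    then show ?thesis
      by (rule LIMSEQ_le_const2) (use near[of k] in \<open>auto simp: add.commute\<close>)
  qed
  \<comment> \<open>Stage \<open>k\<close> secures at least \<open>2 / 3\<close> of
    \<open>(1/3) ^ k * D k\<close>, and the later steps lose at most \<open>1 / 2\<close> of the
    same quantity; the margin is \<open>1 / 6\<close>.\<close>
  have large: "(4/3) ^ k / 6 \<le> \<bar>f (n k) l\<bar>" for k
  proof -
    have "\<bar>f (n k) (l - x (Suc k))\<bar> \<le> D k * norm (l - x (Suc k))"
      unfolding D_def by (intro dual_norm_on_bound f X subspace_diff lX x)
    also have "\<dots> \<le> D k * (3 / 2 * (1/3) ^ Suc k)"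
      using D(2)[of k] tail[of "Suc k"] by (intro mult_left_mono) auto
    also have "\<dots> = (1/3) ^ k * D k / 2"
      by simp
    finally have "\<bar>f (n k) l - f (n k) (x (Suc k))\<bar> \<le> (1/3) ^ k * D k / 2"
      unfolding dual_on_diff[OF f X(1) lX x(1)] .
    moreover have "2 / 3 * ((1/3) ^ k * D k) \<le> \<bar>f (n k) (x (Suc k))\<bar>"
      using x(3)[of k] by (simp add: mult.left_commute)
    ultimately have "(1/3) ^ k * D k / 6 \<le> \<bar>f (n k) l\<bar>"
      by linarith
    moreover have "(1/3) ^ k * 4 ^ k \<le> (1/3) ^ k * D k"
      using D(1)[of k] by (intro mult_left_mono) auto
    then have "(4/3) ^ k \<le> (1/3) ^ k * D k"
      by (simp add: power_mult_distrib[symmetric])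
    ultimately show ?thesis by linarith
  qed
  obtain B where B: "\<And>m. \<bar>f m l\<bar> \<le> B"
    using pointwise[OF lX] by (auto simp: Bseq_def)
  obtain k where "6 * B < (4/3) ^ k"
    using real_arch_pow[of "4/3" "6 * B"] by auto
  with large[of k] B[of "n k"] show thesis by linarith
qed

section \<open>Functionals on free spaces\<close>

text \<open>McShane's extension: an infimum of functions that are \<open>C\<close>-Lipschitz in
  \<open>x\<close> is again \<open>C\<close>-Lipschitz, and at a point of \<open>A\<close> the bound
  on \<open>\<phi>\<close> makes the cone based at that point the smallest.\<close>

lemma real_lipschitz_extension:
  fixes \<phi> :: "'a::metric_space \<Rightarrow> real"
  assumes A: "A \<noteq> {}" and C: "0 \<le> C"
    and \<phi>: "\<And>a b. a \<in> A \<Longrightarrow> b \<in> A \<Longrightarrow> \<bar>\<phi> a - \<phi> b\<bar> \<le> C * dist a b"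
  obtains F where "\<forall>a\<in>A. F a = \<phi> a" and "\<forall>x y. \<bar>F x - F y\<bar> \<le> C * dist x y"
proof -
  define F where "F x = (INF b\<in>A. \<phi> b + C * dist x b)" for x
  obtain a0 where a0: "a0 \<in> A" using A by blast
  have "\<phi> a0 - C * dist x a0 \<le> \<phi> b + C * dist x b" if "b \<in> A" for x b
    using \<phi>[OF a0 that] mult_left_mono[OF dist_triangle3[of a0 b x] C] by (simp add: algebra_simps)
  then have bdd: "bdd_below ((\<lambda>b. \<phi> b + C * dist x b) ` A)" for x
    by (intro bdd_belowI2)
  have le: "F x - F y \<le> C * dist x y" for x y
  proof -
    have "F x - C * dist x y \<le> F y"
      unfolding F_def[of y]
    proof (rule cINF_greatest[OF A])
      fix b assume "b \<in> A"
      then have "F x \<le> \<phi> b + C * dist x b"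
        unfolding F_def by (rule cINF_lower[OF bdd])
      then show "F x - C * dist x y \<le> \<phi> b + C * dist y b"
        using mult_left_mono[OF dist_triangle[of x b y] C] by (simp add: algebra_simps)
    qed
    then show ?thesis by simp
  qed
  have lip: "\<bar>F x - F y\<bar> \<le> C * dist x y" for x y
    using le[of x y] le[of y x] by (simp add: abs_le_iff dist_commute[of y x])
  have "F a = \<phi> a" if "a \<in> A" for a
  proof (rule antisym)
    show "F a \<le> \<phi> a"
      unfolding F_def using cINF_lower[OF bdd that, of a] by simp
    show "\<phi> a \<le> F a"
      unfolding F_def
    proof (rule cINF_greatest[OF A])
      fix b assume "b \<in> A"
      from \<phi>[OF that this] show "\<phi> a \<le> \<phi> b + C * dist a b" by simp
    qed
  qed
  with lip show thesis by (intro that[of F]) auto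
qed

section \<open>Free spaces as closed subspaces, and their duals\<close>

lemma closed_lip_free: "closed (lip_free N)"
  by (simp add: lip_free_def)

lemma span_subset_lip_free: "span (lip0_eval ` N) \<subseteq> lip_free N"
  by (simp add: lip_free_def closure_subset)

lemma lip_free_mono: "N \<subseteq> N' \<Longrightarrow> lip_free N \<subseteq> lip_free N'"
  unfolding lip_free_def by (intro closure_mono span_mono image_mono)

lemma subspace_lip_free: "subspace (lip_free N)"
  unfolding subspace_def
proof (intro conjI ballI allI)
  have lim: "z \<in> lip_free N" if "\<And>n. a n \<in> span (lip0_eval ` N)" "a \<longlonglongrightarrow> z" for a z
    unfolding lip_free_def closure_sequential using that by blast
  show "0 \<in> lip_free N"
    using span_subset_lip_free span_zero by blast
  fix x assume "x \<in> lip_free N"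
  then obtain a where a: "\<And>n. a n \<in> span (lip0_eval ` N)" "a \<longlonglongrightarrow> x"
    unfolding lip_free_def closure_sequential by blast
  show "c *\<^sub>R x \<in> lip_free N" for c
    by (rule lim[OF span_scale[OF a(1)] tendsto_scaleR[OF tendsto_const a(2)]])
  fix y assume "y \<in> lip_free N"
  then obtain b where b: "\<And>n. b n \<in> span (lip0_eval ` N)" "b \<longlonglongrightarrow> y"
    unfolding lip_free_def closure_sequential by blast
  show "x + y \<in> lip_free N"
    by (rule lim[OF span_add[OF a(1) b(1)] tendsto_add[OF a(2) b(2)]])
qed

lemma lip0_eval_0 [simp]: "lip0_eval 0 = 0"
  by (rule blinfun_eqI) simp

lemma lip0_functional_in_dual: "restrict_dual (lip_free N) (\<lambda>\<gamma>. blinfun_apply \<gamma> F) \<in> dual_on (lip_free N)"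
proof (rule dual_onI)
  show "\<bar>restrict_dual (lip_free N) (\<lambda>\<gamma>. blinfun_apply \<gamma> F) \<gamma>\<bar> \<le> norm F * norm \<gamma>" for \<gamma>
    using norm_blinfun[of \<gamma> F] by (simp add: restrict_dual_def mult.commute)
qed (use subspace_lip_free[of N] in
    \<open>auto simp: restrict_dual_def subspace_add subspace_scale blinfun.add_left blinfun.scaleR_left\<close>)

text \<open>Point masses at \<open>a\<close> and \<open>b\<close> differ by at most
  \<open>dist a b\<close> in norm, so \<open>f\<close> restricted to point masses is a Lipschitz
  function, and its extension represents \<open>f\<close>. Extending from \<open>insert 0 B\<close>
  makes it vanish at the base point even if \<open>0\<close> is not in \<open>B\<close>.\<close>

lemma dual_lip_free_representation:
  assumes f: "f \<in> dual_on (lip_free B)"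
  obtains F where "\<forall>\<gamma>\<in>span (lip0_eval ` B). f \<gamma> = blinfun_apply \<gamma> F"
proof -
  note sub = subspace_lip_free[of B]
  define \<phi> where "\<phi> b = f (lip0_eval b)" for b
  obtain C where C: "0 \<le> C" "\<And>\<gamma>. \<gamma> \<in> lip_free B \<Longrightarrow> \<bar>f \<gamma>\<bar> \<le> C * norm \<gamma>"
    using dual_on_bounded[OF f] by blast
  have mem: "lip0_eval b \<in> lip_free B" if "b \<in> insert 0 B" for b
    using that subspace_0[OF sub] span_subset_lip_free[of B] span_base[of "lip0_eval b" "lip0_eval ` B"] by auto
  have \<phi>: "\<bar>\<phi> a - \<phi> b\<bar> \<le> C * dist a b" if "a \<in> insert 0 B" "b \<in> insert 0 B" for a b
  proof -
    have "\<bar>\<phi> a - \<phi> b\<bar> = \<bar>f (lip0_eval a - lip0_eval b)\<bar>"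
      by (simp add: \<phi>_def dual_on_diff[OF f sub mem[OF that(1)] mem[OF that(2)]])
    also have "\<dots> \<le> C * norm (lip0_eval a - lip0_eval b)"
      by (intro C subspace_diff[OF sub] mem that)
    also have "\<dots> \<le> C * dist a b"
      by (intro mult_left_mono norm_lip0_eval_diff_le C)
    finally show ?thesis .
  qed
  obtain F where F: "\<forall>a\<in>insert 0 B. F a = \<phi> a" "\<forall>x y. \<bar>F x - F y\<bar> \<le> C * dist x y"
    by (rule real_lipschitz_extension[OF insert_not_empty C(1) \<phi>])
  have f0: "f 0 = 0"
    using dual_on_scaleR[OF f subspace_0[OF sub], of 0] by simp
  then have "F 0 = 0"
    using F(1) by (simp add: \<phi>_def)
  then have Lip0_F: "lip0_apply (Lip0 F) = F"
    by (rule lip0_apply_Lip0[OF C(1) F(2)[rule_format]])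
  have "f \<gamma> = blinfun_apply \<gamma> (Lip0 F) \<and> \<gamma> \<in> lip_free B" if "\<gamma> \<in> span (lip0_eval ` B)" for \<gamma>
    using that
  proof (induction rule: span_induct_alt)
    case base
    show ?case using f0 subspace_0[OF sub] by simp
  next
    case (step c u \<gamma>)
    then obtain b where b: "b \<in> B" "u = lip0_eval b" by blast
    have u: "u \<in> lip_free B" using mem b by simp
    have "f (c *\<^sub>R u + \<gamma>) = c * f u + f \<gamma>"
      using step u by (simp add: dual_on_add[OF f] dual_on_scaleR[OF f] subspace_scale[OF sub])
    then show ?case
      using step u b F(1) sub
      by (simp add: Lip0_F \<phi>_def blinfun.add_left blinfun.scaleR_left subspace_add subspace_scale)
  qed
  then show thesis by (intro that) blast
qed

text \<open>A perturbation null in norm does not affect weak limits, so the sequence can be moved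
  into the span, where supports are finite as the gliding hump demands.\<close>

lemma weakly_null_approximation:
  assumes x: "weakly_null_on (lip_free N) x"
  obtains \<mu> where "\<forall>n. \<mu> n \<in> span (lip0_eval ` N)" "(\<lambda>n. x n - \<mu> n) \<longlonglongrightarrow> 0"
    "\<forall>F. (\<lambda>n. blinfun_apply (\<mu> n) F) \<longlonglongrightarrow> 0"
proof -
  have xN: "x n \<in> lip_free N" for n
    using x by (simp add: weakly_null_on_def)
  have "\<exists>\<gamma>\<in>span (lip0_eval ` N). dist \<gamma> (x n) < 1 / Suc n" for n
    using xN[of n] unfolding lip_free_def closure_approachable by simp
  then obtain \<mu> where \<mu>: "\<And>n. \<mu> n \<in> span (lip0_eval ` N)" "\<And>n. dist (\<mu> n) (x n) < 1 / Suc n"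
    by metis
  have diff: "(\<lambda>n. x n - \<mu> n) \<longlonglongrightarrow> 0"
  proof (rule Lim_null_comparison[OF always_eventually LIMSEQ_Suc[OF lim_1_over_n]], rule allI)
    show "norm (x n - \<mu> n) \<le> 1 / of_nat (Suc n)" for n
      using \<mu>(2)[of n] by (simp add: dist_norm norm_minus_commute)
  qed
  show thesis
  proof (rule that[OF _ diff], use \<mu>(1) in blast, rule allI)
    fix F
    have "(\<lambda>n. restrict_dual (lip_free N) (\<lambda>\<gamma>. blinfun_apply \<gamma> F) (x n)) \<longlonglongrightarrow> 0"
      using x lip0_functional_in_dual unfolding weakly_null_on_def by blast
    then have "(\<lambda>n. blinfun_apply (x n) F - blinfun_apply (x n - \<mu> n) F) \<longlonglongrightarrow> 0 - blinfun_apply 0 F"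
      by (intro tendsto_diff blinfun.tendsto diff tendsto_const) (simp add: restrict_dual_def xN)
    then show "(\<lambda>n. blinfun_apply (\<mu> n) F) \<longlonglongrightarrow> 0"
      by (simp add: blinfun.diff_left)
  qed
qed

text \<open>Uniform boundedness controls the functionals once and for all. The compact set, and with
  it \<open>B\<close>, depends on the accuracy \<open>e\<close>, which is harmless because only a
  limit is claimed.\<close>

lemma dunford_pettis_compact_determined:
  assumes DP: "\<And>K :: 'a::{complete_space,zero} set. compact K \<Longrightarrow>
      \<exists>B. K \<subseteq> B \<and> dunford_pettis_on (lip_free B)"
  shows "dunford_pettis_on (lip_free (UNIV :: 'a set))"
  unfolding dunford_pettis_on_def
proof (intro allI impI, elim conjE)
  let ?X = "lip_free (UNIV :: 'a set)"
  fix x f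
  assume x: "weakly_null_on ?X x" and f: "dual_weakly_null_on ?X f"
  note sub = subspace_lip_free[of "UNIV :: 'a set"]
  have xX: "x n \<in> ?X" for n
    using x by (simp add: weakly_null_on_def)
  have fX: "f n \<in> dual_on ?X" for n
    using f by (simp add: dual_weakly_null_on_def)
  have bseq: "Bseq (\<lambda>n. f n \<gamma>)" if "\<gamma> \<in> ?X" for \<gamma>
    using dual_weakly_null_pointwise[OF f sub that] by (intro convergent_imp_Bseq convergentI)
  obtain C' where C': "\<forall>n. \<forall>\<gamma>\<in>?X. \<bar>f n \<gamma>\<bar> \<le> C' * norm \<gamma>"
    by (rule uniform_boundedness_dual_on[OF sub closed_lip_free fX bseq])
  \<comment> \<open>The maximum keeps the bound positive, so that \<open>e\<close> can be divided by
    it.\<close>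
  define C where "C = max 1 C'"
  have C: "0 < C" "\<And>n \<gamma>. \<gamma> \<in> ?X \<Longrightarrow> \<bar>f n \<gamma>\<bar> \<le> C * norm \<gamma>"
    by (auto simp: C_def intro: order_trans[OF C'[rule_format] mult_right_mono])
  obtain \<mu> where \<mu>: "\<forall>n. \<mu> n \<in> span (range lip0_eval)" "(\<lambda>n. x n - \<mu> n) \<longlonglongrightarrow> 0"
    "\<forall>F. (\<lambda>n. blinfun_apply (\<mu> n) F) \<longlonglongrightarrow> 0"
    by (rule weakly_null_approximation[OF x])
  show "(\<lambda>n. f n (x n)) \<longlonglongrightarrow> 0"
  proof (rule LIMSEQ_I)
    fix e :: real assume e: "0 < e"
    \<comment> \<open>One third of \<open>e\<close> each for the errors \<open>x n - \<mu> n\<close>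
      and \<open>\<mu> n - y n\<close> and for the term over \<open>B\<close>.\<close>
    define \<epsilon> where "\<epsilon> = e / (3 * C)"
    have \<epsilon>: "0 < \<epsilon>" "C * \<epsilon> = e / 3"
      using e C(1) by (auto simp: \<epsilon>_def)
    obtain K y where K: "compact K" and yK: "\<forall>n. y n \<in> span (lip0_eval ` K)"
      and \<mu>y: "\<forall>n. norm (\<mu> n - y n) \<le> \<epsilon>" and y_null: "\<forall>F. (\<lambda>n. blinfun_apply (y n) F) \<longlonglongrightarrow> 0"
      by (rule compact_reduction[OF \<mu>(1,3)[rule_format] \<epsilon>(1)])
    obtain B where B: "K \<subseteq> B" "dunford_pettis_on (lip_free B)"
      using DP[OF K] by blast
    have yB: "y n \<in> span (lip0_eval ` B)" for n
      using yK span_mono[OF image_mono[OF B(1)], of lip0_eval] by blast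
    then have yB': "y n \<in> lip_free B" for n
      using span_subset_lip_free by blast
    \<comment> \<open>Weak nullness over \<open>B\<close> is tested against the whole dual of
      \<open>lip_free B\<close>; on the span such a functional is given by a Lipschitz function on
      the whole space.\<close>
    have "(\<lambda>n. \<phi> (y n)) \<longlonglongrightarrow> 0" if \<phi>: "\<phi> \<in> dual_on (lip_free B)" for \<phi>
    proof -
      obtain F where "\<forall>\<gamma>\<in>span (lip0_eval ` B). \<phi> \<gamma> = blinfun_apply \<gamma> F"
        by (rule dual_lip_free_representation[OF \<phi>])
      then show ?thesis
        using y_null yB by simp
    qed
    then have "weakly_null_on (lip_free B) y"
      by (simp add: weakly_null_on_def yB')
    moreover have BX: "lip_free B \<subseteq> ?X"
      by (rule lip_free_mono) simp
    then have "dual_weakly_null_on (lip_free B) (\<lambda>n. restrict_dual (lip_free B) (f n))"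
      by (rule dual_weakly_null_restrict[OF f sub subspace_lip_free])
    ultimately have "(\<lambda>n. restrict_dual (lip_free B) (f n) (y n)) \<longlonglongrightarrow> 0"
      using B(2) unfolding dunford_pettis_on_def by blast
    then have fy: "(\<lambda>n. f n (y n)) \<longlonglongrightarrow> 0"
      by (simp add: restrict_dual_def yB')
    obtain N1 where N1: "\<And>n. N1 \<le> n \<Longrightarrow> \<bar>f n (y n)\<bar> < e / 3"
      using LIMSEQ_D[OF fy, of "e / 3"] e by auto
    obtain N2 where N2: "\<And>n. N2 \<le> n \<Longrightarrow> norm (x n - \<mu> n) < \<epsilon>"
      using LIMSEQ_D[OF \<mu>(2) \<epsilon>(1)] by auto
    have "\<bar>f n (x n)\<bar> < e" if n: "max N1 N2 \<le> n" for n
    proof -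
      have \<mu>X: "\<mu> n \<in> ?X" and yX: "y n \<in> ?X"
        using \<mu>(1) span_subset_lip_free[of UNIV] yB'[of n] BX by blast+
      have "f n (x n) = f n (x n - \<mu> n) + f n (\<mu> n - y n) + f n (y n)"
        by (simp add: dual_on_diff[OF fX sub] xX \<mu>X yX)
      moreover have "\<bar>f n (x n - \<mu> n)\<bar> \<le> C * \<epsilon>"
        using N2[of n] n C(1)
        by (intro order_trans[OF C(2)[OF subspace_diff[OF sub xX \<mu>X]] mult_left_mono]) auto
      moreover have "\<bar>f n (\<mu> n - y n)\<bar> \<le> C * \<epsilon>"
        using \<mu>y C(1)
        by (intro order_trans[OF C(2)[OF subspace_diff[OF sub \<mu>X yX]] mult_left_mono]) auto
      ultimately show ?thesis
        using N1[of n] n \<epsilon>(2) by linarith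
    qed
    then show "\<exists>N. \<forall>n\<ge>N. norm (f n (x n) - 0) < e"
      by (intro exI[of _ "max N1 N2"]) simp
  qed
qed

text \<open>The forward direction takes \<open>B = UNIV\<close> for every compact set.\<close>

theorem corollary2p10:
  shows "dunford_pettis_on (lip_free (UNIV :: 'a::{complete_space,zero} set)) \<longleftrightarrow>
    (\<forall>K :: 'a set. compact K \<longrightarrow> (\<exists>B. K \<subseteq> B \<and> dunford_pettis_on (lip_free B)))"
  using dunford_pettis_compact_determined by blast

end
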